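(* Let $p>2$ and let $\mathcal{D}\subset\mathbb{H}$ be open, bounded, connected and game-regular. Then for every bounded $F\in\mathcal{C}(\mathbb{H})$, the family $\{u_\epsilon\}_{\epsilon\to0}$ of the unique bounded continuous solutions of $$u(q)=d_\epsilon(q)\Big(\frac13\mathcal{A}_3(u,\epsilon)(q)+\frac13\inf_{q'\in B_{\gamma_p\epsilon}(q)}\mathcal{A}_3(u,\epsilon)(q')+\frac13\sup_{q'\in B_{\gamma_p\epsilon}(q)}\mathcal{A}_3(u,\epsilon)(q')\Big)+(1-d_\epsilon(q))F(q),\quad q\in\mathbb{H},$$ is equicontinuous in $\bar{\mathcal{D}}$.
   Context: $\mathbb{H}=(\mathbb{R}^3,* )$ is the first Heisenberg group with $(x,y,z)*(x',y',z')=(x+x',y+y',z+z'+\frac12(xy'-yx'))$. The Korányi gauge is $|(x,y,z)|_K=((x^2+y^2)^2+16z^2)^{1/4}$, the metric is $d(q,q')=|q^{-1}*q'|_K$, $B_r(q)=\{q'\in\mathbb{H}: d(q,q')<r\}$, the dilations are $\rho_\lambda(x,y,z)=(\lambda x,\lambda y,\lambda^2z)$, and $|\cdot|$ is the Euclidean norm. Define $\mathcal{A}_3(v,r)(q)=\frac{1}{|B_r(q)|}\int_{B_r(q)}v(p)\,dp$ (Lebesgue measure on $\mathbb{R}^3$), $d_\epsilon(q)=\frac1\epsilon\min\{\epsilon,\mathrm{dist}(q,\mathbb{H}\setminus\mathcal{D})\}$ with $\mathrm{dist}$ taken with respect to $d$, and $\gamma_p=\big(\frac{p-2}{\pi}\big)^{1/2}$.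 The family $\{u_\epsilon\}_{\epsilon\to0}$ is equicontinuous in $\bar{\mathcal{D}}$ means: for every $\eta>0$ there exist $\delta>0$ and $\hat\epsilon\in(0,1)$ such that $|u_\epsilon(q)-u_\epsilon(q')|\le\eta$ for all $\epsilon\in(0,\hat\epsilon)$ and all $q,q'\in\bar{\mathcal{D}}$ with $|q-q'|\le\delta$. Tug of War game with noise on $\mathcal{D}$: let $\Omega_1=B_1(0)\times\{1,2,3\}\times(0,1)$ with the product $\mathbb{P}_1$ of normalized Lebesgue measure on $B_1(0)$, uniform measure on $\{1,2,3\}$ and Lebesgue measure on $(0,1)$ (Borel/discrete $\sigma$-algebras), and let $(\Omega,\mathcal{F},\mathbb{P})$ be the countable product of copies of $\Omega_1$, with elements $\omega=\{(w_i,s_i,t_i)\}_{i\ge1}$. A strategy of a player is a sequence $\sigma=\{\sigma^n\}_{n\ge0}$ of measurable functions $\sigma^n:H_n\to B_1(0)$ on the spaces of finite histories $H_n=\mathbb{H}\times(\mathbb{H}\times\Omega_1)^n$. Given $\epsilon\in(0,1)$, an initial position $q_0\in\mathbb{H}$ and strategies $\sigma_I,\sigma_{II}$ of the two players, the positions $Q_n=Q_n^{\epsilon,q_0,\sigma_I,\sigma_{II}}:\Omega\to\mathbb{H}$ are: $Q_0=q_0$ and, with $q_k=Q_k$ and $h_{n-1}=(q_0,(q_1,w_1,s_1,t_1),\ldots,(q_{n-1},w_{n-1},s_{n-1},t_{n-1}))\in H_{n-1}$, $$Q_n=\begin{cases}q_{n-1}*\rho_{\gamma_p\epsilon}(\sigma_I^{n-1}(h_{n-1}))*\rho_\epsilon(w_n)&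 s_n=1\\ q_{n-1}*\rho_{\gamma_p\epsilon}(\sigma_{II}^{n-1}(h_{n-1}))*\rho_\epsilon(w_n)& s_n=2\\ q_{n-1}*\rho_\epsilon(w_n)& s_n=3.\end{cases}$$ The stopping time is $\tau=\tau^{\epsilon,q_0,\sigma_I,\sigma_{II}}=\min\{n\ge1:\ t_n>d_\epsilon(q_{n-1})\}$, which is almost surely finite. A point $q_0\in\partial\mathcal{D}$ is game-regular if for every $\eta,\delta>0$ there exist $\hat\delta\in(0,\delta)$ and $\hat\epsilon\in(0,1)$ such that for every $\epsilon\in(0,\hat\epsilon)$ and every initial position $p_0\in B_{\hat\delta}(q_0)$ there exists a strategy $\sigma_{0,I}$ with the property that for every strategy $\sigma_{II}$: $\mathbb{P}\big((Q^{\epsilon,p_0,\sigma_{0,I},\sigma_{II}})_{\tau-1}\in B_\delta(q_0)\big)\ge1-\eta$. The domain $\mathcal{D}$ is game-regular if every $q_0\in\partial\mathcal{D}$ is game-regular. *)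

theory Defs
  imports "HOL-Probability.Probability"
begin

section \<open>The first Heisenberg group\<close>

text \<open>The Heisenberg group lives on \<^typ>\<open>real \<times> real \<times> real\<close>, whose library norm, topology and
  measure \<^term>\<open>lborel\<close> are those of Euclidean three-space; its unit is \<^term>\<open>0\<close>.\<close>

type_synonym heis = "real \<times> real \<times> real"

definition hmult :: "heis \<Rightarrow> heis \<Rightarrow> heis"  (infixl "\<star>" 70) where
  "q \<star> q' = (case q of (x, y, z) \<Rightarrow> case q' of (x', y', z') \<Rightarrow>
     (x + x', y + y', z + z' + (x * y' - y * x') / 2))"

definition hinv :: "heis \<Rightarrow> heis" where
  "hinv q = (case q of (x, y, z) \<Rightarrow> (- x, - y, - z))"

lemma hmult_hinv: "q \<star> hinv q = 0" "hinv q \<star> q = 0"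
  by (cases q, simp add: hmult_def hinv_def zero_prod_def)+

definition koranyi :: "heis \<Rightarrow> real" where
  "koranyi q = (case q of (x, y, z) \<Rightarrow> root 4 ((x\<^sup>2 + y\<^sup>2)\<^sup>2 + 16 * z\<^sup>2))"

definition hdist :: "heis \<Rightarrow> heis \<Rightarrow> real" where
  "hdist q q' = koranyi (hinv q \<star> q')"

definition hball :: "heis \<Rightarrow> real \<Rightarrow> heis set" where
  "hball q r = {q'. hdist q q' < r}"

definition dilation :: "real \<Rightarrow> heis \<Rightarrow> heis" where
  "dilation r q = (case q of (x, y, z) \<Rightarrow> (r * x, r * y, r\<^sup>2 * z))"

section \<open>Averages and the mean value equation\<close>

definition average3 :: "(heis \<Rightarrow> real) \<Rightarrow> real \<Rightarrow> heis \<Rightarrow> real" where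
  "average3 v r q = (LINT p:hball q r|lborel. v p) / measure lborel (hball q r)"

definition hinfdist :: "heis \<Rightarrow> heis set \<Rightarrow> real" where
  "hinfdist q S = (INF q'\<in>S. hdist q q')"

definition d_cut :: "heis set \<Rightarrow> real \<Rightarrow> heis \<Rightarrow> real" where
  "d_cut D \<epsilon> q = min \<epsilon> (hinfdist q (- D)) / \<epsilon>"

definition gamma_p :: "real \<Rightarrow> real" where
  "gamma_p p = sqrt ((p - 2) / pi)"

definition solves_mve ::
    "real \<Rightarrow> heis set \<Rightarrow> (heis \<Rightarrow> real) \<Rightarrow> real \<Rightarrow> (heis \<Rightarrow> real) \<Rightarrow> bool" where
  "solves_mve p D F \<epsilon> u \<longleftrightarrow> (\<forall>q.
     u q = d_cut D \<epsilon> q *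
         (1/3 * average3 u \<epsilon> q
          + 1/3 * (INF q'\<in>hball q (gamma_p p * \<epsilon>). average3 u \<epsilon> q')
          + 1/3 * (SUP q'\<in>hball q (gamma_p p * \<epsilon>). average3 u \<epsilon> q'))
       + (1 - d_cut D \<epsilon> q) * F q)"

definition bdd_cont_solution ::
    "real \<Rightarrow> heis set \<Rightarrow> (heis \<Rightarrow> real) \<Rightarrow> real \<Rightarrow> (heis \<Rightarrow> real) \<Rightarrow> bool" where
  "bdd_cont_solution p D F \<epsilon> u \<longleftrightarrow>
     bounded (range u) \<and> continuous_on UNIV u \<and> solves_mve p D F \<epsilon> u"

definition u_eps :: "real \<Rightarrow> heis set \<Rightarrow> (heis \<Rightarrow> real) \<Rightarrow> real \<Rightarrow> heis \<Rightarrow> real" where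
  "u_eps p D F \<epsilon> = (THE u. bdd_cont_solution p D F \<epsilon> u)"

text \<open>Equicontinuity for small parameters, with respect to the Euclidean norm.\<close>

definition equicontinuous_family :: "heis set \<Rightarrow> (real \<Rightarrow> heis \<Rightarrow> real) \<Rightarrow> bool" where
  "equicontinuous_family S u \<longleftrightarrow> (\<forall>\<eta>>0. \<exists>\<delta>>0. \<exists>\<epsilon>'\<in>{0<..<1}. \<forall>\<epsilon>\<in>{0<..<\<epsilon>'}.
     \<forall>q\<in>S. \<forall>q'\<in>S. norm (q - q') \<le> \<delta> \<longrightarrow> \<bar>u \<epsilon> q - u \<epsilon> q'\<bar> \<le> \<eta>)"

section \<open>Tug of War with noise\<close>

type_synonym outcome1 = "heis \<times> nat \<times> real"

definition Omega1 :: "outcome1 measure" where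
  "Omega1 = uniform_measure (restrict_space lborel (hball 0 1)) (hball 0 1)
     \<Otimes>\<^sub>M (uniform_count_measure {1, 2, 3} \<Otimes>\<^sub>M restrict_space lborel {0<..<1})"

definition Omega :: "(nat \<Rightarrow> outcome1) measure" where
  "Omega = (\<Pi>\<^sub>M i\<in>{1..}. Omega1)"

text \<open>A history of length \<open>n\<close> consists of the initial position and a family, indexed by
  \<open>1, \<dots>, n\<close>, of positions paired with outcomes. Only the measurable structure of
  \<^term>\<open>histories n\<close> is used.\<close>

type_synonym history = "heis \<times> (nat \<Rightarrow> heis \<times> outcome1)"

definition histories :: "nat \<Rightarrow> history measure" where
  "histories n = borel \<Otimes>\<^sub>M (\<Pi>\<^sub>M i\<in>{1..n}. borel \<Otimes>\<^sub>M Omega1)"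

type_synonym strategy = "nat \<Rightarrow> history \<Rightarrow> heis"

definition is_strategy :: "strategy \<Rightarrow> bool" where
  "is_strategy \<sigma> \<longleftrightarrow> (\<forall>n. \<sigma> n \<in> histories n \<rightarrow>\<^sub>M restrict_space borel (hball 0 1))"

lemma restrict_fundef_cong [fundef_cong]:
  "I = J \<Longrightarrow> (\<And>i. i \<in> J \<Longrightarrow> f i = g i) \<Longrightarrow> restrict f I = restrict g J"
  by (auto simp: restrict_def fun_eq_iff)

fun position ::
    "real \<Rightarrow> real \<Rightarrow> heis \<Rightarrow> strategy \<Rightarrow> strategy \<Rightarrow> nat \<Rightarrow> (nat \<Rightarrow> outcome1) \<Rightarrow> heis" where
  "position p \<epsilon> q0 \<sigma>I \<sigma>II 0 \<omega> = q0"
| "position p \<epsilon> q0 \<sigma>I \<sigma>II (Suc n) \<omega> =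
    (let q = position p \<epsilon> q0 \<sigma>I \<sigma>II n \<omega>;
         h = (q0, \<lambda>k\<in>{1..n}. (position p \<epsilon> q0 \<sigma>I \<sigma>II k \<omega>, \<omega> k));
         (w, s, t) = \<omega> (Suc n)
     in if s = 1 then q \<star> dilation (gamma_p p * \<epsilon>) (\<sigma>I n h) \<star> dilation \<epsilon> w
        else if s = 2 then q \<star> dilation (gamma_p p * \<epsilon>) (\<sigma>II n h) \<star> dilation \<epsilon> w
        else q \<star> dilation \<epsilon> w)"

text \<open>On the null event that the game never stops, \<open>LEAST\<close> yields an unspecified constant.\<close>

definition stop_time ::
    "real \<Rightarrow> heis set \<Rightarrow> real \<Rightarrow> heis \<Rightarrow> strategy \<Rightarrow> strategy \<Rightarrow> (nat \<Rightarrow> outcome1) \<Rightarrow> nat" where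
  "stop_time p D \<epsilon> q0 \<sigma>I \<sigma>II \<omega> = (LEAST n. 1 \<le> n \<and>
     (case \<omega> n of (w, s, t) \<Rightarrow> t > d_cut D \<epsilon> (position p \<epsilon> q0 \<sigma>I \<sigma>II (n - 1) \<omega>)))"

definition stopped_position ::
    "real \<Rightarrow> heis set \<Rightarrow> real \<Rightarrow> heis \<Rightarrow> strategy \<Rightarrow> strategy \<Rightarrow> (nat \<Rightarrow> outcome1) \<Rightarrow> heis" where
  "stopped_position p D \<epsilon> q0 \<sigma>I \<sigma>II \<omega> =
     position p \<epsilon> q0 \<sigma>I \<sigma>II (stop_time p D \<epsilon> q0 \<sigma>I \<sigma>II \<omega> - 1) \<omega>"

definition game_regular_point :: "real \<Rightarrow> heis set \<Rightarrow> heis \<Rightarrow> bool" where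
  "game_regular_point p D q0 \<longleftrightarrow> (\<forall>\<eta>>0. \<forall>\<delta>>0. \<exists>\<delta>'\<in>{0<..<\<delta>}. \<exists>\<epsilon>'\<in>{0<..<1}.
     \<forall>\<epsilon>\<in>{0<..<\<epsilon>'}. \<forall>p0\<in>hball q0 \<delta>'. \<exists>\<sigma>I. is_strategy \<sigma>I \<and> (\<forall>\<sigma>II. is_strategy \<sigma>II \<longrightarrow>
       measure Omega {\<omega> \<in> space Omega. stopped_position p D \<epsilon> p0 \<sigma>I \<sigma>II \<omega> \<in> hball q0 \<delta>}
         \<ge> 1 - \<eta>))"

definition game_regular :: "real \<Rightarrow> heis set \<Rightarrow> bool" where
  "game_regular p D \<longleftrightarrow> (\<forall>q0\<in>frontier D. game_regular_point p D q0)"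

end

theory Submission
  imports Defs
begin

text \<open>The equation is a fixed point problem that becomes a contraction in a sup norm weighted by a barrier \<open>\<phi>\<close>:
  a bounded function with \<open>1/3 A\<phi> + 2/3 sup \<phi> \<le> \<theta> \<phi>\<close> on \<open>D\<close> for some \<open>\<theta> < 1\<close>. The same barrier bounds the
  probability that the game survives \<open>n\<close> steps by a multiple of \<open>\<theta>\<^sup>n\<close>.

  If player II answers any strategy of player I by maximising the averages of \<open>u\<close> up to an error
  \<open>\<eta> / 2\<^sup>n\<^sup>+\<^sup>1\<close> at step \<open>n\<close>, then \<open>u (Q\<^sub>n)\<close> is a submartingale up to a total error \<open>\<eta>\<close>, hence \<open>u\<close> at the
  starting point is at most the expected payoff plus \<open>\<eta>\<close>. When player I uses the strategy given by
  game-regularity, the payoff is close to the boundary value; the reverse bound is the same statement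
  for \<open>- u\<close> and \<open>- F\<close>. By compactness of the boundary the oscillation of \<open>u\<^sub>\<epsilon>\<close> is uniformly small in a
  boundary layer. Left translations preserve the equation, so comparing \<open>u\<^sub>\<epsilon>\<close> with a small left translate of
  itself carries the estimate from the layer to the interior.\<close>

text \<open>The solution is never identified with the value of the game, and no minimax theorem is
  involved. Game-regularity already supplies one strategy of player I that is good against every
  opponent, so the opponent may be chosen to suit the estimate: a maximiser of \<open>u\<close> for
  the upper bound, of \<open>- u\<close> for the lower one. The obstacle to a contraction is the
  supremum and infimum over a ball, which may see larger values of \<open>\<phi>\<close> than the
  centre. These terms are charged with a global bound \<open>C\<close> of \<open>\<phi>\<close>, so
  all the strict decrease must come from the pure noise term of weight \<open>1/3\<close>. This
  forces a barrier whose steepness depends on \<open>\<epsilon>\<close>. Its rate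
  \<open>\<theta>\<close> tends to 1 as \<open>\<epsilon>\<close> tends to 0; this is harmless,
  since for fixed \<open>\<epsilon>\<close> the number of iterations is sent to infinity and the
  final bounds do not contain \<open>\<theta>\<close>. The translation is on the left because moves
  and noise multiply on the right and so commute with it. The cutoff and \<open>F\<close> do not, so
  the comparison is confined to points where the cutoff is 1 before and after translation.\<close>

no_notation convolution (infix "\<star>" 50)

section \<open>The Heisenberg group\<close>

lemma hmult_Pair [simp]:
  "(x, y, z) \<star> (x', y', z') = (x + x', y + y', z + z' + (x * y' - y * x') / 2)"
  by (simp add: hmult_def)

lemma hinv_Pair [simp]: "hinv (x, y, z) = (- x, - y, - z)"
  by (simp add: hinv_def)

lemma dilation_Pair [simp]: "dilation r (x, y, z) = (r * x, r * y, r\<^sup>2 * z)"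
  by (simp add: dilation_def)

lemma hmult_assoc: "(a \<star> b) \<star> c = a \<star> (b \<star> c)"
  by (cases a, cases b, cases c) (simp add: field_simps)

lemma hmult_zero [simp]: "0 \<star> q = q" "q \<star> 0 = q"
  by (cases q, simp add: hmult_def zero_prod_def)+

lemma hinv_zero [simp]: "hinv 0 = 0"
  by (simp add: hinv_def zero_prod_def)

lemma hinv_hmult: "hinv (a \<star> b) = hinv b \<star> hinv a"
  by (cases a, cases b) (simp add: field_simps)

lemma hinv_hinv [simp]: "hinv (hinv a) = a"
  by (cases a) simp

lemma hinv_hmult_cancel [simp]: "hinv a \<star> (a \<star> b) = b" "a \<star> (hinv a \<star> b) = b"
  by (simp_all add: hmult_assoc [symmetric] hmult_hinv)

lemma hdist_hmult_left [simp]: "hdist (g \<star> a) (g \<star> b) = hdist a b"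
  by (simp add: hdist_def hinv_hmult hmult_assoc)

lemma hdist_zero_left [simp]: "hdist 0 q = koranyi q"
  by (simp add: hdist_def)

text \<open>The fourth root becomes the square root of a complex modulus, so homogeneity, coordinate
  bounds and the triangle inequality of the gauge reduce to facts about complex numbers.\<close>

lemma koranyi_Pair: "koranyi (x, y, z) = sqrt (cmod (Complex (x\<^sup>2 + y\<^sup>2) (4 * z)))"
proof -
  have "root 4 a = sqrt (sqrt a)" for a
    using real_root_mult_exp [of 2 2 a] by (simp add: sqrt_def)
  then show ?thesis
    by (simp add: koranyi_def cmod_def power_mult_distrib)
qed

lemma koranyi_nonneg [simp]: "0 \<le> koranyi q"
  by (cases q) (simp add: koranyi_Pair)

lemma koranyi_zero [simp]: "koranyi 0 = 0"
  by (simp add: koranyi_def zero_prod_def)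

lemma koranyi_hinv [simp]: "koranyi (hinv q) = koranyi q"
  by (cases q) (simp add: koranyi_def)

text \<open>With \<open>\<zeta> = x + i y\<close> and \<open>A = \<bar>\<zeta>\<bar>\<^sup>2 + 4 i z\<close>, the square of the gauge is \<open>\<bar>A\<bar>\<close>, and the
  number \<open>A\<close> of a product is \<open>A + A' + 2 cnj \<zeta> \<zeta>'\<close>.\<close>
lemma koranyi_hmult_le: "koranyi (a \<star> b) \<le> koranyi a + koranyi b"
proof -
  obtain x y z x' y' z' where ab: "a = (x, y, z)" "b = (x', y', z')"
    by (metis prod_cases3)
  define A where "A = Complex (x\<^sup>2 + y\<^sup>2) (4 * z)"
  define B where "B = Complex (x'\<^sup>2 + y'\<^sup>2) (4 * z')"
  define s where "s = Complex x y"
  define t where "t = Complex x' y'"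
  have k: "koranyi a = sqrt (cmod A)" "koranyi b = sqrt (cmod B)"
    by (simp_all add: ab koranyi_Pair A_def B_def)
  have kab: "koranyi (a \<star> b) = sqrt (cmod (A + B + 2 * (cnj s * t)))"
  proof -
    have "Complex ((x + x')\<^sup>2 + (y + y')\<^sup>2) (4 * (z + z' + (x * y' - y * x') / 2))
        = A + B + 2 * (cnj s * t)"
      by (simp add: A_def B_def s_def t_def complex_eq_iff power2_eq_square field_simps)
    then show ?thesis by (simp only: ab hmult_Pair koranyi_Pair)
  qed
  \<comment> \<open>\<open>(cmod s)\<^sup>2\<close> is the real part of \<open>A\<close>, and
    \<open>(cmod t)\<^sup>2\<close> that of \<open>B\<close>.\<close>
  moreover have "(cmod s)\<^sup>2 \<le> cmod A" "(cmod t)\<^sup>2 \<le> cmod B"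
    using complex_Re_le_cmod [of A] complex_Re_le_cmod [of B]
    by (simp_all add: s_def t_def cmod_power2 A_def B_def)
  then have "cmod s \<le> koranyi a" "cmod t \<le> koranyi b"
    by (simp_all add: k real_le_rsqrt)
  then have "cmod s * cmod t \<le> koranyi a * koranyi b"
    by (intro mult_mono) auto
  moreover have "cmod (A + B + 2 * (cnj s * t)) \<le> cmod A + cmod B + 2 * (cmod s * cmod t)"
    by (intro order_trans [OF norm_triangle_ineq] add_mono)
      (auto simp: norm_mult norm_triangle_ineq)
  ultimately have "cmod (A + B + 2 * (cnj s * t)) \<le> (koranyi a + koranyi b)\<^sup>2"
    by (simp add: power2_sum k)
  then show ?thesis
    using kab by (simp add: real_le_lsqrt)
qed

lemma hdist_commute: "hdist a b = hdist b a"
proof -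
  have "hinv b \<star> a = hinv (hinv a \<star> b)"
    by (simp add: hinv_hmult)
  then show ?thesis
    by (simp add: hdist_def)
qed

lemma hdist_triangle: "hdist a c \<le> hdist a b + hdist b c"
  using koranyi_hmult_le [of "hinv a \<star> b" "hinv b \<star> c"] by (simp add: hdist_def hmult_assoc)

lemma hdist_nonneg [simp]: "0 \<le> hdist a b"
  by (simp add: hdist_def)

lemma hdist_self [simp]: "hdist a a = 0"
  by (simp add: hdist_def hmult_hinv)

lemma hdist_hmult_right [simp]: "hdist q (q \<star> w) = koranyi w"
  by (simp add: hdist_def)

lemma koranyi_dilation: "0 \<le> r \<Longrightarrow> koranyi (dilation r q) = r * koranyi q"
proof (cases q)
  case (fields x y z)
  assume "0 \<le> r"
  have "Complex ((r * x)\<^sup>2 + (r * y)\<^sup>2) (4 * (r\<^sup>2 * z))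
      = of_real (r\<^sup>2) * Complex (x\<^sup>2 + y\<^sup>2) (4 * z)"
    by (simp add: complex_eq_iff algebra_simps power2_eq_square)
  then show ?thesis
    using \<open>0 \<le> r\<close> by (simp only: fields dilation_Pair koranyi_Pair norm_mult norm_of_real)
      (simp add: real_sqrt_mult)
qed

lemma dilation_inverse: "r \<noteq> 0 \<Longrightarrow> dilation r (dilation (1 / r) q) = q"
  by (cases q) (simp add: power_one_over)

lemma in_hball_zero [simp]: "w \<in> hball 0 r \<longleftrightarrow> koranyi w < r"
  by (simp add: hball_def)

text \<open>With this parametrisation a supremum over a ball with moving centre becomes a supremum
  over a fixed index set, whose points are exactly the admissible moves of a player.\<close>

lemma hball_eq_image:
  assumes "0 < r"
  shows "hball q r = (\<lambda>w. q \<star> dilation r w) ` hball 0 1"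
proof (intro set_eqI iffI)
  fix q' assume "q' \<in> hball q r"
  then have "koranyi (hinv q \<star> q') < r"
    by (simp add: hball_def hdist_def)
  then have "koranyi (dilation (1 / r) (hinv q \<star> q')) < 1"
    using assms by (simp add: koranyi_dilation)
  then show "q' \<in> (\<lambda>w. q \<star> dilation r w) ` hball 0 1"
    using assms
    by (intro image_eqI [of _ _ "dilation (1 / r) (hinv q \<star> q')"]) (auto simp: dilation_inverse)
next
  fix q' assume "q' \<in> (\<lambda>w. q \<star> dilation r w) ` hball 0 1"
  then obtain w where "q' = q \<star> dilation r w" "koranyi w < 1"
    by auto
  then show "q' \<in> hball q r"
    using assms by (simp add: hball_def koranyi_dilation)
qed

lemma hmult_dilation_in_hball_iff:
  "0 < r \<Longrightarrow> q \<star> dilation r w \<in> hball q r \<longleftrightarrow> w \<in> hball 0 1"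
  by (simp add: hball_def koranyi_dilation)

section \<open>Comparison of the gauge with the Euclidean norm\<close>

lemma abs_fst_le_koranyi: "\<bar>fst w\<bar> \<le> koranyi w"
  and abs_fst_snd_le_koranyi: "\<bar>fst (snd w)\<bar> \<le> koranyi w"
  and abs_snd_snd_le_koranyi: "4 * \<bar>snd (snd w)\<bar> \<le> (koranyi w)\<^sup>2"
proof -
  obtain x y z where w: "w = (x, y, z)"
    by (metis prod_cases3)
  let ?A = "Complex (x\<^sup>2 + y\<^sup>2) (4 * z)"
  have "x\<^sup>2 + y\<^sup>2 \<le> cmod ?A"
    using complex_Re_le_cmod [of ?A] by simp
  then have "x\<^sup>2 \<le> cmod ?A" "y\<^sup>2 \<le> cmod ?A"
    using zero_le_power2 [of x] zero_le_power2 [of y] by linarith+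
  then show "\<bar>fst w\<bar> \<le> koranyi w" "\<bar>fst (snd w)\<bar> \<le> koranyi w"
    by (auto simp: w koranyi_Pair intro!: real_le_rsqrt)
  show "4 * \<bar>snd (snd w)\<bar> \<le> (koranyi w)\<^sup>2"
    using abs_Im_le_cmod [of ?A] by (simp add: w koranyi_Pair abs_mult)
qed

lemma norm_triple_le: "norm (x, y, z :: real) \<le> \<bar>x :: real\<bar> + \<bar>y :: real\<bar> + \<bar>z\<bar>"
proof -
  have "norm (x, y, z) \<le> norm x + norm (y, z)"
    by (rule norm_Pair_le)
  also have "norm (y, z) \<le> norm y + norm z"
    by (rule norm_Pair_le)
  finally show ?thesis by simp
qed

text \<open>The twist in the third coordinate of the product couples the step \<open>w\<close> with
  the position \<open>q\<close>, hence a factor growing with \<open>norm q\<close>. The third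
  coordinate of \<open>w\<close> itself is of order \<open>r\<^sup>2\<close>, which
  \<open>r \<le> 1\<close> turns into a linear bound.\<close>

lemma norm_hmult_diff_le:
  assumes "koranyi w \<le> r" "r \<le> 1"
  shows "norm (q \<star> w - q) \<le> r * (3 + norm q)"
proof -
  obtain x y z a b c where qw: "q = (x, y, z)" "w = (a, b, c)"
    by (metis prod_cases3)
  have r: "0 \<le> r"
    using assms koranyi_nonneg [of w] by linarith
  have ab: "\<bar>a\<bar> \<le> r" "\<bar>b\<bar> \<le> r"
    using abs_fst_le_koranyi [of w] abs_fst_snd_le_koranyi [of w] assms qw by auto
  have "(koranyi w)\<^sup>2 \<le> r * 1"
    unfolding power2_eq_square using assms r by (intro mult_mono) auto
  then have c: "\<bar>c\<bar> \<le> r"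
    using abs_snd_snd_le_koranyi [of w] qw r by auto
  have xy: "\<bar>x\<bar> \<le> norm q" "\<bar>y\<bar> \<le> norm q"
    using norm_fst_le [of x "(y, z)"] norm_snd_le [of "(y, z)" x] norm_fst_le [of y z]
    by (auto simp: qw)
  have "\<bar>x * b\<bar> \<le> norm q * r" "\<bar>y * a\<bar> \<le> norm q * r"
    unfolding abs_mult using ab xy by (auto intro!: mult_mono)
  then have "\<bar>c + (x * b - y * a) / 2\<bar> \<le> r + norm q * r"
    using c unfolding abs_le_iff by (simp add: field_simps)
  then show ?thesis
    using norm_triple_le [of a b "c + (x * b - y * a) / 2"] ab
    by (simp add: qw algebra_simps)
qed

lemma hball_subset_ball:
  assumes "bounded D" "0 < \<kappa>"
  shows "\<exists>r>0. \<forall>q\<in>D. hball q r \<subseteq> ball q \<kappa>"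
proof -
  obtain B where B: "0 < B" "\<And>q. q \<in> D \<Longrightarrow> norm q \<le> B"
    using assms(1) by (auto simp: bounded_pos)
  \<comment> \<open>On \<open>D\<close> the constant of \<open>norm_hmult_diff_le\<close> is at most
    \<open>3 + B\<close>; the factor 2 leaves room for a strict inequality.\<close>
  define r where "r = min 1 (\<kappa> / (2 * (3 + B)))"
  have r: "0 < r" "r \<le> 1" "r * (3 + B) < \<kappa>"
  proof -
    show "0 < r" "r \<le> 1" using assms(2) B by (auto simp: r_def)
    have "r * (3 + B) \<le> \<kappa> / (2 * (3 + B)) * (3 + B)"
      using B by (intro mult_right_mono) (auto simp: r_def)
    also have "\<dots> = \<kappa> / 2"
      using B by (simp add: field_simps)
    finally show "r * (3 + B) < \<kappa>" using assms(2) by linarith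
  qed
  have "q' \<in> ball q \<kappa>" if "q \<in> D" "q' \<in> hball q r" for q q'
  proof -
    have "koranyi (hinv q \<star> q') \<le> r"
      using that by (simp add: hball_def hdist_def)
    from norm_hmult_diff_le [OF this r(2), of q]
    have "norm (q' - q) \<le> r * (3 + norm q)" by simp
    also have "\<dots> \<le> r * (3 + B)"
      using B(2)[OF that(1)] r by (intro mult_left_mono) auto
    finally show ?thesis
      using r(3) by (simp add: dist_norm norm_minus_commute)
  qed
  then show ?thesis using r(1) by blast
qed

lemma continuous_on_hmult [continuous_intros]:
  fixes f g :: "'a::topological_space \<Rightarrow> heis"
  assumes "continuous_on S f" "continuous_on S g"
  shows "continuous_on S (\<lambda>x. f x \<star> g x)"
  unfolding hmult_def case_prod_beta using assms by (intro continuous_intros) auto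

lemma continuous_on_hinv [continuous_intros]:
  fixes f :: "'a::topological_space \<Rightarrow> heis"
  assumes "continuous_on S f"
  shows "continuous_on S (\<lambda>x. hinv (f x))"
  unfolding hinv_def case_prod_beta using assms by (intro continuous_intros) auto

lemma continuous_on_dilation [continuous_intros]:
  fixes f :: "'a::topological_space \<Rightarrow> heis"
  assumes "continuous_on S f" "continuous_on S r"
  shows "continuous_on S (\<lambda>x. dilation (r x) (f x))"
  unfolding dilation_def case_prod_beta using assms by (intro continuous_intros) auto

lemma continuous_on_koranyi [continuous_intros]:
  fixes f :: "'a::topological_space \<Rightarrow> heis"
  assumes "continuous_on S f"
  shows "continuous_on S (\<lambda>x. koranyi (f x))"
  unfolding koranyi_def case_prod_beta using assms by (intro continuous_intros) auto

lemma continuous_on_hdist [continuous_intros]: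
  fixes f g :: "'a::topological_space \<Rightarrow> heis"
  assumes "continuous_on S f" "continuous_on S g"
  shows "continuous_on S (\<lambda>x. hdist (f x) (g x))"
  unfolding hdist_def using assms by (intro continuous_intros)

lemma open_hball: "open (hball q r)"
  unfolding hball_def by (intro open_Collect_less continuous_intros)

lemma center_in_hball [simp]: "q \<in> hball q r \<longleftrightarrow> 0 < r"
  by (simp add: hball_def)

lemma hball_nonempty: "0 < r \<Longrightarrow> hball q r \<noteq> {}"
  using center_in_hball by blast

lemma bounded_hball_zero: "bounded (hball 0 1)"
proof (rule boundedI)
  fix w :: heis assume "w \<in> hball 0 1"
  then have "koranyi w \<le> 1" by simp
  from norm_hmult_diff_le [OF this, of 0] show "norm w \<le> 3" by simp
qed

section \<open>Gauge distance to a set and the cutoff\<close>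

lemma hinfdist_le: "q' \<in> S \<Longrightarrow> hinfdist q S \<le> hdist q q'"
  unfolding hinfdist_def by (rule cINF_lower) (auto intro!: bdd_belowI [of _ 0])

lemma hinfdist_greatest: "S \<noteq> {} \<Longrightarrow> (\<And>q'. q' \<in> S \<Longrightarrow> c \<le> hdist q q') \<Longrightarrow> c \<le> hinfdist q S"
  unfolding hinfdist_def by (rule cINF_greatest)

text \<open>The function is 1-Lipschitz for \<open>hdist\<close>, and \<open>hdist a\<close> is
  continuous for the Euclidean topology and vanishes at \<open>a\<close>.\<close>

lemma continuous_on_hinfdist:
  assumes "S \<noteq> {}"
  shows "continuous_on UNIV (\<lambda>q. hinfdist q S)"
proof -
  have lip: "hinfdist a S \<le> hinfdist b S + hdist a b" for a b
  proof -
    have "hinfdist a S - hdist a b \<le> hinfdist b S"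
    proof (rule hinfdist_greatest [OF assms])
      fix q' assume "q' \<in> S"
      from hinfdist_le [OF this, of a] hdist_triangle [of a q' b]
      show "hinfdist a S - hdist a b \<le> hdist b q'" by linarith
    qed
    then show ?thesis by linarith
  qed
  have "((\<lambda>q. hinfdist q S) \<longlongrightarrow> hinfdist a S) (at a)" for a
  proof (rule LIM_zero_cancel, rule Lim_null_comparison)
    have "norm (hinfdist q S - hinfdist a S) \<le> hdist a q" for q
      using lip [of a q] lip [of q a] hdist_commute [of q a] by simp
    then show "\<forall>\<^sub>F q in at a. norm (hinfdist q S - hinfdist a S) \<le> hdist a q"
      by (intro always_eventually allI)
    have "continuous_on UNIV (\<lambda>q. hdist a q)"
      by (intro continuous_intros)
    then have "((\<lambda>q. hdist a q) \<longlongrightarrow> hdist a a) (at a)"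
      by (simp only: continuous_on_def UNIV_I simp_thms ball_simps)
    then show "((\<lambda>q. hdist a q) \<longlongrightarrow> 0) (at a)" by simp
  qed
  then show ?thesis by (simp add: continuous_on_def)
qed

lemma hinfdist_eq_0: "q \<in> S \<Longrightarrow> hinfdist q S = 0"
  using hinfdist_le [of q S q] hinfdist_greatest [of S 0 q] by fastforce

text \<open>The cutoff is built on an infimum over \<open>- D\<close>, which carries information
  only for a nonempty set.\<close>

lemma Compl_bounded_nonempty:
  fixes D :: "heis set"
  shows "bounded D \<Longrightarrow> - D \<noteq> {}"
  using not_bounded_UNIV [where 'a = heis] by (metis Compl_empty_eq double_complement)

lemma d_cut_bounds:
  assumes "bounded D" "0 < \<epsilon>"
  shows "0 \<le> d_cut D \<epsilon> q" "d_cut D \<epsilon> q \<le> 1"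
proof -
  have "- D \<noteq> {}"
    using assms(1) by (rule Compl_bounded_nonempty)
  then have "0 \<le> hinfdist q (- D)"
    by (intro hinfdist_greatest) auto
  then show "0 \<le> d_cut D \<epsilon> q" "d_cut D \<epsilon> q \<le> 1"
    using assms(2) by (auto simp: d_cut_def)
qed

lemma continuous_on_d_cut:
  assumes "bounded D" "0 < \<epsilon>"
  shows "continuous_on UNIV (d_cut D \<epsilon>)"
proof -
  have "- D \<noteq> {}"
    using assms(1) by (rule Compl_bounded_nonempty)
  then show ?thesis
    unfolding d_cut_def using assms(2)
    by (intro continuous_intros continuous_on_hinfdist) auto
qed

lemma d_cut_eq_0: "q \<notin> D \<Longrightarrow> 0 < \<epsilon> \<Longrightarrow> d_cut D \<epsilon> q = 0"
  by (simp add: d_cut_def hinfdist_eq_0)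

lemma d_cut_eq_1:
  assumes "bounded D" "0 < \<epsilon>" "hball q \<epsilon> \<subseteq> D"
  shows "d_cut D \<epsilon> q = 1"
proof -
  have "- D \<noteq> {}"
    using assms(1) by (rule Compl_bounded_nonempty)
  then have "\<epsilon> \<le> hinfdist q (- D)"
    using assms(3) by (intro hinfdist_greatest) (auto simp: hball_def not_less [symmetric])
  then show ?thesis
    using assms(2) by (simp add: d_cut_def)
qed

section \<open>Averages over Heisenberg balls\<close>

text \<open>In coordinates the map is triangular: each image coordinate is affine in its own
  variable, with a shift depending on the earlier ones only. Fubini and three one-dimensional
  substitutions give the Jacobian \<open>r * r * r\<^sup>2\<close> for every \<open>q\<close>. This
  contains both the left invariance of Lebesgue measure and the homogeneous dimension 4.\<close>

lemma nn_integral_left_dilation: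
  fixes f :: "heis \<Rightarrow> ennreal"
  assumes [measurable]: "f \<in> borel_measurable borel" and r: "0 < r"
  shows "(\<integral>\<^sup>+p. f p \<partial>lborel) = ennreal (r ^ 4) * (\<integral>\<^sup>+p. f (q \<star> dilation r p) \<partial>lborel)"
proof -
  obtain a b c where q: "q = (a, b, c)"
    by (metis prod_cases3)
  have split: "(\<integral>\<^sup>+p. g p \<partial>lborel) = (\<integral>\<^sup>+x. \<integral>\<^sup>+y. \<integral>\<^sup>+z. g (x, y, z) \<partial>lborel \<partial>lborel \<partial>lborel)"
    if [measurable]: "g \<in> borel_measurable borel" for g :: "heis \<Rightarrow> ennreal"
  proof -
    have g1: "g \<in> borel_measurable (lborel \<Otimes>\<^sub>M (lborel :: (real \<times> real) measure))"
      by (simp add: borel_prod lborel_prod)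
    have g2: "(\<lambda>w. g (x, w)) \<in> borel_measurable (lborel \<Otimes>\<^sub>M (lborel :: real measure))" for x
      by (simp add: borel_prod lborel_prod)
    have "(\<integral>\<^sup>+p. g p \<partial>lborel) = (\<integral>\<^sup>+p. g p \<partial>(lborel \<Otimes>\<^sub>M lborel))"
      by (simp add: lborel_prod)
    also have "\<dots> = (\<integral>\<^sup>+x. \<integral>\<^sup>+w. g (x, w) \<partial>lborel \<partial>lborel)"
      by (rule lborel.nn_integral_fst [OF g1, symmetric])
    also have "\<dots> = (\<integral>\<^sup>+x. \<integral>\<^sup>+w. g (x, w) \<partial>(lborel \<Otimes>\<^sub>M lborel) \<partial>lborel)"
      by (simp add: lborel_prod)
    also have "\<dots> = (\<integral>\<^sup>+x. \<integral>\<^sup>+y. \<integral>\<^sup>+z. g (x, y, z) \<partial>lborel \<partial>lborel \<partial>lborel)"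
      by (simp add: lborel.nn_integral_fst [OF g2, symmetric])
    finally show ?thesis .
  qed
  have pair: "(\<lambda>z. f (x, y, z)) \<in> borel_measurable borel" for x y
    by measurable
  have meas_y: "(\<lambda>y. \<integral>\<^sup>+z. f (x, y, z) \<partial>lborel) \<in> borel_measurable borel" for x
    by measurable
  have meas_x: "(\<lambda>x. \<integral>\<^sup>+y. \<integral>\<^sup>+z. f (x, y, z) \<partial>lborel \<partial>lborel) \<in> borel_measurable borel"
    by measurable
  define Z where "Z x y = c + (a * (r * y) - b * (r * x)) / 2" for x y
  have T: "q \<star> dilation r (x, y, z) = (a + r * x, b + r * y, Z x y + r\<^sup>2 * z)" for x y z
    by (simp add: q Z_def)
  have mT: "(\<lambda>p. f (q \<star> dilation r p)) \<in> borel_measurable borel"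
  proof -
    have "(\<lambda>p. q \<star> dilation r p) \<in> borel_measurable borel"
      by (intro borel_measurable_continuous_onI continuous_intros)
    then show ?thesis by measurable
  qed
  have "(\<integral>\<^sup>+p. f p \<partial>lborel) = (\<integral>\<^sup>+x. \<integral>\<^sup>+y. \<integral>\<^sup>+z. f (x, y, z) \<partial>lborel \<partial>lborel \<partial>lborel)"
    by (rule split) simp
  also have "\<dots> = ennreal r * (\<integral>\<^sup>+x. \<integral>\<^sup>+y. \<integral>\<^sup>+z. f (a + r * x, y, z) \<partial>lborel \<partial>lborel \<partial>lborel)"
    using r by (subst nn_integral_real_affine [OF meas_x, of r a]) auto
  also have "\<dots> = ennreal r * (\<integral>\<^sup>+x. ennreal r *
      (\<integral>\<^sup>+y. \<integral>\<^sup>+z. f (a + r * x, b + r * y, z) \<partial>lborel \<partial>lborel) \<partial>lborel)"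
    using r by (subst nn_integral_real_affine [OF meas_y, of r _ b]) auto
  also have "\<dots> = ennreal r * (\<integral>\<^sup>+x. ennreal r *
      (\<integral>\<^sup>+y. ennreal (r\<^sup>2) * (\<integral>\<^sup>+z. f (a + r * x, b + r * y, Z x y + r\<^sup>2 * z) \<partial>lborel) \<partial>lborel) \<partial>lborel)"
  proof -
    have "(\<integral>\<^sup>+z. f (a + r * x, b + r * y, z) \<partial>lborel)
        = ennreal (r\<^sup>2) * (\<integral>\<^sup>+z. f (a + r * x, b + r * y, Z x y + r\<^sup>2 * z) \<partial>lborel)" for x y
      using r by (subst nn_integral_real_affine [OF pair, of "r\<^sup>2" _ _ "Z x y"]) auto
    then show ?thesis by simp
  qed
  also have "\<dots> = ennreal r * (ennreal r * (ennreal (r\<^sup>2) * (\<integral>\<^sup>+x.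
      (\<integral>\<^sup>+y. (\<integral>\<^sup>+z. f (a + r * x, b + r * y, Z x y + r\<^sup>2 * z) \<partial>lborel) \<partial>lborel) \<partial>lborel)))"
  proof -
    have "(\<lambda>y. \<integral>\<^sup>+z. f (a + r * x, b + r * y, Z x y + r\<^sup>2 * z) \<partial>lborel)
        \<in> borel_measurable borel" for x
      unfolding Z_def by measurable
    moreover have "(\<lambda>x. \<integral>\<^sup>+y. \<integral>\<^sup>+z. f (a + r * x, b + r * y, Z x y + r\<^sup>2 * z) \<partial>lborel \<partial>lborel)
        \<in> borel_measurable borel"
      unfolding Z_def by measurable
    ultimately show ?thesis
      by (simp add: nn_integral_cmult)
  qed
  also have "\<dots> = ennreal (r ^ 4) * (\<integral>\<^sup>+x.
      (\<integral>\<^sup>+y. (\<integral>\<^sup>+z. f (a + r * x, b + r * y, Z x y + r\<^sup>2 * z) \<partial>lborel) \<partial>lborel) \<partial>lborel)"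
  proof -
    have "r ^ 4 = r * (r * r\<^sup>2)"
      by (simp add: power4_eq_xxxx power2_eq_square)
    then show ?thesis
      using r by (simp add: ennreal_mult mult.assoc)
  qed
  also have "\<dots> = ennreal (r ^ 4) * (\<integral>\<^sup>+p. f (q \<star> dilation r p) \<partial>lborel)"
    by (simp only: split [OF mT] T)
  finally show ?thesis .
qed

text \<open>As an identity of measures the substitution also serves integrals of signed
  functions.\<close>

lemma lborel_left_dilation:
  assumes r: "0 < r"
  shows "lborel = density (distr lborel borel (\<lambda>p. q \<star> dilation r p)) (\<lambda>_. ennreal (r ^ 4))"
proof (rule measure_eqI)
  have m: "(\<lambda>p. q \<star> dilation r p) \<in> borel_measurable borel"
    by (intro borel_measurable_continuous_onI continuous_intros)
  then have [measurable]: "(\<lambda>p. q \<star> dilation r p) \<in> lborel \<rightarrow>\<^sub>M borel"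
    by simp
  fix A :: "heis set" assume A: "A \<in> sets lborel"
  then have "emeasure lborel A = (\<integral>\<^sup>+p. indicator A p \<partial>lborel)"
    by simp
  also have "\<dots> = ennreal (r ^ 4) * (\<integral>\<^sup>+p. indicator A (q \<star> dilation r p) \<partial>lborel)"
    using A r by (intro nn_integral_left_dilation) auto
  also have "\<dots> = emeasure (density (distr lborel borel (\<lambda>p. q \<star> dilation r p)) (\<lambda>_. ennreal (r ^ 4))) A"
  proof -
    have "(\<integral>\<^sup>+p. indicator A (q \<star> dilation r p) \<partial>lborel)
        = emeasure (distr lborel borel (\<lambda>p. q \<star> dilation r p)) A"
      using A nn_integral_distr [of "\<lambda>p. q \<star> dilation r p" lborel borel "indicator A"] by simp
    then show ?thesis
      using A by (simp add: emeasure_density nn_integral_cmult)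
  qed
  finally show "emeasure lborel A = \<dots>" .
qed simp

text \<open>The first factor of \<^const>\<open>Omega1\<close>.\<close>

definition noise :: "heis measure" where
  "noise = uniform_measure (restrict_space lborel (hball 0 1)) (hball 0 1)"

lemma hball_borel [measurable]: "hball q r \<in> sets borel"
  by (rule borel_open [OF open_hball])

lemma emeasure_hball_zero: "emeasure lborel (hball 0 1) < \<infinity>"
  by (rule emeasure_bounded_finite [OF bounded_hball_zero])

lemma emeasure_open_pos:
  fixes U :: "'a::euclidean_space set"
  assumes "open U" "U \<noteq> {}"
  shows "0 < emeasure lborel U"
proof (rule ccontr)
  assume "\<not> ?thesis"
  then have "U \<in> null_sets lborel"
    using assms(1) by (auto intro: null_setsI)
  then have "negligible U"
    using negligible_iff_null_sets null_sets_completionI by blast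
  then show False
    using assms open_not_negligible by blast
qed

lemma measure_hball_zero_pos: "0 < measure lborel (hball 0 1)"
  using emeasure_open_pos [OF open_hball hball_nonempty, of 1 0] emeasure_hball_zero
  by (simp add: measure_def enn2real_positive_iff)

lemma prob_space_noise: "prob_space noise"
  unfolding noise_def
  using emeasure_open_pos [OF open_hball hball_nonempty, of 1 0] emeasure_hball_zero
  by (intro prob_space_uniform_measure) (auto simp: emeasure_restrict_space)

interpretation noise: prob_space noise
  by (rule prob_space_noise)

lemma space_noise [simp]: "space noise = hball 0 1"
  by (simp add: noise_def space_restrict_space)

lemma sets_noise [measurable_cong]: "sets noise = sets (restrict_space borel (hball 0 1))"
  by (simp add: noise_def sets_restrict_space)

lemma borel_measurable_noise:
  "f \<in> borel_measurable borel \<Longrightarrow> f \<in> borel_measurable noise"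
  by (simp add: measurable_cong_sets [OF sets_noise refl] measurable_restrict_space1)

lemma integral_noise:
  fixes f :: "heis \<Rightarrow> real"
  assumes "f \<in> borel_measurable borel"
  shows "(LINT w|noise. f w) = (LINT w:hball 0 1|lborel. f w) / measure lborel (hball 0 1)"
proof -
  let ?R = "restrict_space lborel (hball 0 1)"
  have e: "emeasure ?R (hball 0 1) = emeasure lborel (hball 0 1)"
    by (simp add: emeasure_restrict_space)
  have m: "emeasure lborel (hball 0 1) = ennreal (measure lborel (hball 0 1))"
    using emeasure_hball_zero by (simp add: emeasure_eq_ennreal_measure)
  have fR: "f \<in> borel_measurable ?R"
    using assms by (simp add: measurable_restrict_space1)
  have "noise = density ?R (\<lambda>x. indicator (hball 0 1) x / emeasure ?R (hball 0 1))"
    by (simp add: noise_def uniform_measure_def)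
  also have "\<dots> = density ?R (\<lambda>x. ennreal (1 / measure lborel (hball 0 1)))"
  proof (intro density_cong AE_I2)
    fix x assume "x \<in> space ?R"
    then show "indicator (hball 0 1) x / emeasure ?R (hball 0 1)
        = ennreal (1 / measure lborel (hball 0 1))"
      using measure_hball_zero_pos divide_ennreal [of 1 "measure lborel (hball 0 1)"]
      by (simp add: e m space_restrict_space)
  qed (auto intro!: measurable_restrict_space1)
  finally have nd: "noise = density ?R (\<lambda>x. ennreal (1 / measure lborel (hball 0 1)))" .
  have "(LINT w|noise. f w) = (LINT w|?R. (1 / measure lborel (hball 0 1)) *\<^sub>R f w)"
    unfolding nd by (rule integral_density) (use fR in auto)
  also have "\<dots> = (LINT w|?R. f w) / measure lborel (hball 0 1)"
    by simp
  also have "(LINT w|?R. f w) = (LINT w:hball 0 1|lborel. f w)"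
    by (simp add: integral_restrict_space set_lebesgue_integral_def)
  finally show ?thesis .
qed

text \<open>The Jacobian \<open>r ^ 4\<close> occurs in the integral and in the volume of the ball
  and cancels. This identifies the average in the equation with the mean over one noise step of the
  game.\<close>

lemma average3_eq:
  assumes f: "f \<in> borel_measurable borel" and r: "0 < r"
  shows "average3 f r q = (LINT w|noise. f (q \<star> dilation r w))"
proof -
  let ?T = "\<lambda>p. q \<star> dilation r p"
  have m: "?T \<in> borel_measurable borel"
    by (intro borel_measurable_continuous_onI continuous_intros)
  then have mT [measurable]: "?T \<in> lborel \<rightarrow>\<^sub>M borel"
    by simp
  have [measurable]: "f \<in> borel_measurable borel" by (fact f)
  have int: "(LINT p|lborel. g p) = r ^ 4 * (LINT p|lborel. g (?T p))"
    if [measurable]: "g \<in> borel_measurable borel" for g :: "heis \<Rightarrow> real"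
  proof -
    have "(LINT p|lborel. g p) = (LINT p|density (distr lborel borel ?T) (\<lambda>_. ennreal (r ^ 4)). g p)"
      using lborel_left_dilation [OF r, of q] by simp
    also have "\<dots> = r ^ 4 * (LINT p|lborel. g (?T p))"
      using r by (simp add: integral_density integral_distr)
    finally show ?thesis .
  qed
  have ind: "indicator (hball q r) (?T p) = (indicator (hball 0 1) p :: real)" for p
    using hmult_dilation_in_hball_iff [OF r, of q p] by (simp add: indicator_def)
  have num: "(LINT p:hball q r|lborel. f p) = r ^ 4 * (LINT p:hball 0 1|lborel. f (?T p))"
    unfolding set_lebesgue_integral_def by (subst int) (auto simp: ind)
  have "measure lborel (hball q r) = (LINT p|lborel. indicator (hball q r) p)"
    by simp
  also have "\<dots> = r ^ 4 * (LINT p|lborel. indicator (hball 0 1) p)"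
    by (subst int) (auto simp: ind)
  finally have den: "measure lborel (hball q r) = r ^ 4 * measure lborel (hball 0 1)"
    by simp
  have "(\<lambda>p. f (?T p)) \<in> borel_measurable borel"
    using m by measurable
  from integral_noise [OF this] show ?thesis
    using r by (simp add: average3_def num den)
qed

section \<open>The mean value operator\<close>

lemma bcontfun_iff: "f \<in> bcontfun \<longleftrightarrow> continuous_on UNIV f \<and> bounded (range f)"
  by (simp add: bcontfun_def)

lemma bcontfun_bound:
  fixes f :: "'a::topological_space \<Rightarrow> real"
  assumes "f \<in> bcontfun"
  shows "\<exists>K>0. \<forall>x. \<bar>f x\<bar> \<le> K"
  using assms unfolding bcontfun_iff bounded_pos by auto

lemma bcontfun_borel_measurable:
  fixes f :: "'a::topological_space \<Rightarrow> real"
  shows "f \<in> bcontfun \<Longrightarrow> f \<in> borel_measurable borel"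
  by (simp add: bcontfun_iff borel_measurable_continuous_onI)

lemma bcontfun_real_intros:
  fixes f g :: "'a::topological_space \<Rightarrow> real"
  shows "(\<lambda>x. c :: real) \<in> (bcontfun :: ('a \<Rightarrow> real) set)"
    and "f \<in> bcontfun \<Longrightarrow> (\<lambda>x. c * f x) \<in> bcontfun"
    and "f \<in> bcontfun \<Longrightarrow> g \<in> bcontfun \<Longrightarrow> (\<lambda>x. f x + g x) \<in> bcontfun"
    and "f \<in> bcontfun \<Longrightarrow> g \<in> bcontfun \<Longrightarrow> (\<lambda>x. f x - g x) \<in> bcontfun"
    and "f \<in> bcontfun \<Longrightarrow> (\<lambda>x. - f x) \<in> bcontfun"
    and "f \<in> bcontfun \<Longrightarrow> g \<in> bcontfun \<Longrightarrow> (\<lambda>x. f x * g x) \<in> bcontfun"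
proof -
  show "(\<lambda>x. c :: real) \<in> (bcontfun :: ('a \<Rightarrow> real) set)"
    by (rule const_bcontfun)
  show "(\<lambda>x. c * f x) \<in> bcontfun" if "f \<in> bcontfun"
    using scaleR_cont [OF that, of c] by simp
  show "(\<lambda>x. f x + g x) \<in> bcontfun" if "f \<in> bcontfun" "g \<in> bcontfun"
    by (rule plus_cont [OF that])
  show "(\<lambda>x. f x - g x) \<in> bcontfun" if "f \<in> bcontfun" "g \<in> bcontfun"
    by (rule minus_cont [OF that])
  show "(\<lambda>x. - f x) \<in> bcontfun" if "f \<in> bcontfun"
    by (rule uminus_cont [OF that])
  show "(\<lambda>x. f x * g x) \<in> bcontfun" if f: "f \<in> bcontfun" and g: "g \<in> bcontfun"
  proof -
    obtain K where K: "0 < K" "\<And>x. \<bar>f x\<bar> \<le> K" using bcontfun_bound [OF f] by blast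
    obtain L where L: "0 < L" "\<And>x. \<bar>g x\<bar> \<le> L" using bcontfun_bound [OF g] by blast
    have "\<bar>f x * g x\<bar> \<le> K * L" for x
      unfolding abs_mult using K L by (intro mult_mono) auto
    moreover have "continuous_on UNIV (\<lambda>x. f x * g x)"
      using f g by (intro continuous_intros) (auto simp: bcontfun_iff)
    ultimately show ?thesis
      by (intro bcontfun_normI [where b = "K * L"]) auto
  qed
qed

lemma abs_SUP_diff_le:
  fixes f g :: "'a \<Rightarrow> real"
  assumes B: "B \<noteq> {}" "bdd_above (f ` B)" "bdd_above (g ` B)"
    and le: "\<And>x. x \<in> B \<Longrightarrow> \<bar>f x - g x\<bar> \<le> e"
  shows "\<bar>(SUP x\<in>B. f x) - (SUP x\<in>B. g x)\<bar> \<le> e"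
proof -
  have "(SUP x\<in>B. f x) \<le> (SUP x\<in>B. g x) + e"
  proof (rule cSUP_least [OF B(1)])
    fix x assume x: "x \<in> B"
    from cSUP_upper [OF x B(3)] le [OF x] show "f x \<le> (SUP x\<in>B. g x) + e" by linarith
  qed
  moreover have "(SUP x\<in>B. g x) \<le> (SUP x\<in>B. f x) + e"
  proof (rule cSUP_least [OF B(1)])
    fix x assume x: "x \<in> B"
    from cSUP_upper [OF x B(2)] le [OF x] show "g x \<le> (SUP x\<in>B. f x) + e" by linarith
  qed
  ultimately show ?thesis by linarith
qed

text \<open>True without any boundedness, since the infimum of reals is defined as a negated
  supremum. Every fact about infima below is a sign change of one about suprema.\<close>

lemma INF_real_eq: "(INF x\<in>B. f x) = - (SUP x\<in>B. - f x :: real)"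
  by (simp add: Inf_real_def image_image)

lemma SUP_real_uminus: "(SUP x\<in>B. - f x :: real) = - (INF x\<in>B. f x)"
  by (simp add: INF_real_eq)

lemma INF_real_uminus: "(INF x\<in>B. - f x :: real) = - (SUP x\<in>B. f x)"
  by (simp add: INF_real_eq)

lemma bdd_image_bcontfun:
  fixes f :: "'a::topological_space \<Rightarrow> real"
  assumes "f \<in> bcontfun"
  shows "bdd_above (f ` B)" "bdd_below (f ` B)"
proof -
  obtain K where K: "\<And>x. \<bar>f x\<bar> \<le> K" using bcontfun_bound [OF assms] by blast
  then show "bdd_above (f ` B)" "bdd_below (f ` B)"
    by (auto intro!: bdd_aboveI2 [where M = K] bdd_belowI2 [where m = "- K"] simp: abs_le_iff
      minus_le_iff)
qed

lemma abs_INF_diff_le: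
  fixes f g :: "'a \<Rightarrow> real"
  assumes "B \<noteq> {}" "bdd_below (f ` B)" "bdd_below (g ` B)"
    and "\<And>x. x \<in> B \<Longrightarrow> \<bar>f x - g x\<bar> \<le> e"
  shows "\<bar>(INF x\<in>B. f x) - (INF x\<in>B. g x)\<bar> \<le> e"
proof -
  have "bdd_above ((\<lambda>x. - f x) ` B)" "bdd_above ((\<lambda>x. - g x) ` B)"
    using assms(2,3) bdd_above_uminus [of "f ` B"] bdd_above_uminus [of "g ` B"]
    by (simp_all add: image_image)
  then have "\<bar>(SUP x\<in>B. - f x) - (SUP x\<in>B. - g x)\<bar> \<le> e"
    using assms(4) by (intro abs_SUP_diff_le [OF assms(1)]) (auto simp: abs_minus_commute)
  then show ?thesis by (simp add: INF_real_eq abs_minus_commute)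
qed

text \<open>Over the fixed unit ball the functions of the centre form an equicontinuous family near
  \<open>a\<close>, because \<open>h\<close> is uniformly continuous on the compact set
  \<open>C\<close> of nearby centres and limits of moves. A supremum of an equicontinuous family is
  continuous.\<close>

lemma SUP_hball_bcontfun:
  fixes f :: "heis \<Rightarrow> real"
  assumes f: "f \<in> bcontfun" and r: "0 < r"
  shows "(\<lambda>q. SUP q'\<in>hball q r. f q') \<in> bcontfun"
proof -
  let ?g = "\<lambda>q w. f (q \<star> dilation r w)"
  obtain K where K: "\<And>x. \<bar>f x\<bar> \<le> K" using bcontfun_bound [OF f] by blast
  have bdd: "bdd_above (?g q ` hball 0 1)" for q
    by (intro bdd_aboveI2 [where M = K] order_trans [OF abs_ge_self K])
  have ne: "hball 0 1 \<noteq> {}"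
    by (simp add: hball_nonempty)
  have eq: "(SUP q'\<in>hball q r. f q') = (SUP w\<in>hball 0 1. ?g q w)" for q
    by (simp add: hball_eq_image [OF r] image_image)
  have "\<exists>d>0. \<forall>q. dist q a < d \<longrightarrow> dist (SUP w\<in>hball 0 1. ?g q w) (SUP w\<in>hball 0 1. ?g a w) < e"
    if e: "0 < e" for a e
  proof -
    define C where "C = cball a 1 \<times> closure (hball 0 1)"
    define h where "h x = f (fst x \<star> dilation r (snd x))" for x
    have "compact C"
      unfolding C_def by (intro compact_Times compact_cball) (simp add: compact_closure bounded_hball_zero)
    moreover have "continuous_on C h"
      unfolding h_def
      by (rule continuous_on_compose2 [of UNIV f])
        (use f in \<open>auto simp: bcontfun_iff intro!: continuous_intros\<close>)
    ultimately have "uniformly_continuous_on C h"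
      by (rule compact_uniformly_continuous [rotated])
    moreover have "0 < e / 2" using e by simp
    ultimately obtain d where d: "0 < d"
      "\<forall>x\<in>C. \<forall>y\<in>C. dist y x < d \<longrightarrow> dist (h y) (h x) < e / 2"
      unfolding uniformly_continuous_on_def by blast
    have "dist (SUP w\<in>hball 0 1. ?g q w) (SUP w\<in>hball 0 1. ?g a w) < e"
      if q: "dist q a < min d 1" for q
    proof -
      have "\<bar>?g q w - ?g a w\<bar> \<le> e / 2" if w: "w \<in> hball 0 1" for w
      proof -
        have "(q, w) \<in> C" "(a, w) \<in> C"
          using q w closure_subset [of "hball 0 1"] by (auto simp: C_def dist_commute)
        moreover have "dist (q, w) (a, w) < d"
          using q by (simp add: dist_Pair_Pair)
        ultimately show ?thesis
          using d(2) [rule_format, of "(a, w)" "(q, w)"] by (simp add: dist_real_def h_def)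
      qed
      then have "\<bar>(SUP w\<in>hball 0 1. ?g q w) - (SUP w\<in>hball 0 1. ?g a w)\<bar> \<le> e / 2"
        by (rule abs_SUP_diff_le [OF ne bdd bdd])
      then show ?thesis
        using e by (simp add: dist_real_def)
    qed
    then show ?thesis using d(1) by (intro exI [of _ "min d 1"]) auto
  qed
  then have "continuous_on UNIV (\<lambda>q. SUP q'\<in>hball q r. f q')"
    unfolding eq continuous_on_iff by auto
  moreover have "\<bar>SUP q'\<in>hball q r. f q'\<bar> \<le> K" for q
    unfolding eq
  proof -
    have "\<bar>(SUP w\<in>hball 0 1. ?g q w) - (SUP w\<in>hball 0 1. 0 :: real)\<bar> \<le> K"
      by (rule abs_SUP_diff_le [OF ne bdd]) (auto intro!: bdd_aboveI2 K)
    then show "\<bar>SUP w\<in>hball 0 1. ?g q w\<bar> \<le> K"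
      using ne by simp
  qed
  ultimately show ?thesis
    by (intro bcontfun_normI) auto
qed

lemma INF_hball_bcontfun:
  fixes f :: "heis \<Rightarrow> real"
  assumes f: "f \<in> bcontfun" and r: "0 < r"
  shows "(\<lambda>q. INF q'\<in>hball q r. f q') \<in> bcontfun"
  unfolding INF_real_eq using assms by (intro bcontfun_real_intros SUP_hball_bcontfun)

lemma integrable_noise:
  fixes f :: "heis \<Rightarrow> real"
  assumes f: "f \<in> bcontfun"
  shows "integrable noise (\<lambda>w. f (q \<star> dilation r w))"
proof -
  obtain K where K: "\<And>x. \<bar>f x\<bar> \<le> K" using bcontfun_bound [OF f] by blast
  have "continuous_on UNIV (\<lambda>w. f (q \<star> dilation r w))"
    by (rule continuous_on_compose2 [of UNIV f])
      (use f in \<open>auto simp: bcontfun_iff intro!: continuous_intros\<close>)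
  then have "(\<lambda>w. f (q \<star> dilation r w)) \<in> borel_measurable noise"
    by (intro borel_measurable_noise borel_measurable_continuous_onI)
  then show ?thesis
    by (rule noise.integrable_const_bound [where B = K, rotated]) (simp add: K)
qed

section \<open>Calculus of averages\<close>

context
  fixes \<epsilon> :: real
  assumes eps: "0 < \<epsilon>"
begin

lemma average3_noise:
  fixes f :: "heis \<Rightarrow> real"
  shows "f \<in> bcontfun \<Longrightarrow> average3 f \<epsilon> q = (LINT w|noise. f (q \<star> dilation \<epsilon> w))"
  using eps by (simp add: average3_eq bcontfun_borel_measurable)

lemma average3_mono:
  fixes f g :: "heis \<Rightarrow> real"
  assumes "f \<in> bcontfun" "g \<in> bcontfun" "\<And>p. p \<in> hball q \<epsilon> \<Longrightarrow> f p \<le> g p"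
  shows "average3 f \<epsilon> q \<le> average3 g \<epsilon> q"
  unfolding average3_noise [OF assms(1)] average3_noise [OF assms(2)]
  using assms eps hmult_dilation_in_hball_iff [OF eps, of q]
  by (intro integral_mono integrable_noise) auto

lemma average3_affine:
  fixes f :: "heis \<Rightarrow> real"
  assumes "f \<in> bcontfun"
  shows "average3 (\<lambda>p. c + m * f p) \<epsilon> q = c + m * average3 f \<epsilon> q"
  using integrable_noise [OF assms] assms noise.prob_space
  by (simp add: average3_noise bcontfun_real_intros)

lemma average3_const [simp]: "average3 (\<lambda>p. c) \<epsilon> q = c"
  using noise.prob_space by (simp add: average3_noise bcontfun_real_intros)

lemma average3_diff:
  fixes f g :: "heis \<Rightarrow> real"
  assumes "f \<in> bcontfun" "g \<in> bcontfun"
  shows "average3 (\<lambda>p. f p - g p) \<epsilon> q = average3 f \<epsilon> q - average3 g \<epsilon> q"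
  using integrable_noise [OF assms(1)] integrable_noise [OF assms(2)] assms
  by (simp add: average3_noise bcontfun_real_intros)

lemma average3_uminus:
  fixes f :: "heis \<Rightarrow> real"
  shows "f \<in> bcontfun \<Longrightarrow> average3 (\<lambda>p. - f p) \<epsilon> q = - average3 f \<epsilon> q"
  by (simp add: average3_noise bcontfun_real_intros)

lemma average3_le_const:
  fixes f :: "heis \<Rightarrow> real"
  assumes "f \<in> bcontfun" "\<And>p. f p \<le> c"
  shows "average3 f \<epsilon> q \<le> c"
  using average3_mono [OF assms(1) bcontfun_real_intros(1), of q c] assms(2) by simp

lemma average3_abs_diff_le:
  fixes f g h :: "heis \<Rightarrow> real"
  assumes "f \<in> bcontfun" "g \<in> bcontfun" "h \<in> bcontfun"
    and "\<And>p. p \<in> hball q \<epsilon> \<Longrightarrow> \<bar>f p - g p\<bar> \<le> h p"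
  shows "\<bar>average3 f \<epsilon> q - average3 g \<epsilon> q\<bar> \<le> average3 h \<epsilon> q"
proof -
  have "average3 (\<lambda>p. f p - g p) \<epsilon> q \<le> average3 h \<epsilon> q"
       "average3 (\<lambda>p. g p - f p) \<epsilon> q \<le> average3 h \<epsilon> q"
    using assms by (intro average3_mono bcontfun_real_intros; force simp: abs_le_iff)+
  then show ?thesis
    using assms by (simp add: average3_diff)
qed

lemma average3_bcontfun:
  fixes f :: "heis \<Rightarrow> real"
  assumes f: "f \<in> bcontfun"
  shows "average3 f \<epsilon> \<in> bcontfun"
proof -
  obtain K where K: "0 < K" "\<And>x. \<bar>f x\<bar> \<le> K" using bcontfun_bound [OF f] by blast
  have "continuous_on UNIV (\<lambda>q. LINT w|noise. f (q \<star> dilation \<epsilon> w))"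
    unfolding continuous_on_sequentially comp_def
  proof (intro ballI allI impI)
    fix x :: "nat \<Rightarrow> heis" and a
    assume x: "(\<forall>n. x n \<in> UNIV) \<and> x \<longlonglongrightarrow> a"
    show "(\<lambda>n. LINT w|noise. f (x n \<star> dilation \<epsilon> w)) \<longlonglongrightarrow> (LINT w|noise. f (a \<star> dilation \<epsilon> w))"
    proof (rule integral_dominated_convergence [where w = "\<lambda>_. K"])
      show "AE w in noise. (\<lambda>n. f (x n \<star> dilation \<epsilon> w)) \<longlonglongrightarrow> f (a \<star> dilation \<epsilon> w)"
      proof (rule AE_I2)
        fix w
        have "continuous_on UNIV (\<lambda>q. f (q \<star> dilation \<epsilon> w))"
          by (rule continuous_on_compose2 [of UNIV f])
            (use f in \<open>auto simp: bcontfun_iff intro!: continuous_intros\<close>)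
        then show "(\<lambda>n. f (x n \<star> dilation \<epsilon> w)) \<longlonglongrightarrow> f (a \<star> dilation \<epsilon> w)"
          using x unfolding continuous_on_sequentially comp_def by blast
      qed
    qed (use K integrable_noise [OF f] in auto)
  qed
  moreover have "norm (average3 f \<epsilon> q) \<le> K" for q
    using average3_abs_diff_le [OF f bcontfun_real_intros(1) bcontfun_real_intros(1), of q 0 K] K(2)
    by simp
  ultimately show ?thesis
    by (intro bcontfun_normI) (simp_all add: average3_noise [OF f])
qed

end

definition mv_operator :: "real \<Rightarrow> real \<Rightarrow> (heis \<Rightarrow> real) \<Rightarrow> heis \<Rightarrow> real" where
  "mv_operator p \<epsilon> u q = 1/3 * average3 u \<epsilon> q
     + 1/3 * (INF q'\<in>hball q (gamma_p p * \<epsilon>). average3 u \<epsilon> q')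
     + 1/3 * (SUP q'\<in>hball q (gamma_p p * \<epsilon>). average3 u \<epsilon> q')"

lemma solves_mve_iff:
  "solves_mve p D F \<epsilon> u \<longleftrightarrow>
    (\<forall>q. u q = d_cut D \<epsilon> q * mv_operator p \<epsilon> u q + (1 - d_cut D \<epsilon> q) * F q)"
  by (simp add: solves_mve_def mv_operator_def)

lemma gamma_p_pos: "2 < p \<Longrightarrow> 0 < gamma_p p"
  by (simp add: gamma_p_def)

lemma mv_operator_bcontfun:
  assumes "2 < p" "0 < \<epsilon>" "u \<in> bcontfun"
  shows "mv_operator p \<epsilon> u \<in> bcontfun"
  unfolding mv_operator_def using assms gamma_p_pos [OF assms(1)]
  by (intro bcontfun_real_intros SUP_hball_bcontfun INF_hball_bcontfun average3_bcontfun) auto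

lemma mv_operator_uminus:
  assumes "0 < \<epsilon>" "u \<in> bcontfun"
  shows "mv_operator p \<epsilon> (\<lambda>q. - u q) q = - mv_operator p \<epsilon> u q"
  using assms by (simp add: mv_operator_def average3_uminus SUP_real_uminus INF_real_uminus)

lemma hball_subset_hball:
  assumes "q' \<in> hball q r"
  shows "hball q' s \<subseteq> hball q (r + s)"
proof
  fix x assume "x \<in> hball q' s"
  then show "x \<in> hball q (r + s)"
    using assms hdist_triangle [of q x q'] by (simp add: hball_def)
qed

text \<open>The sup and inf terms are compared only through the upper bound \<open>C\<close> of the weight.\<close>

lemma mv_operator_abs_diff_le:
  assumes p: "2 < p" and \<epsilon>: "0 < \<epsilon>"
    and u: "u \<in> bcontfun" and v: "v \<in> bcontfun" and \<phi>: "\<phi> \<in> bcontfun"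
    and C: "\<And>q. \<phi> q \<le> C" and m: "0 \<le> m"
    and le: "\<And>x. x \<in> hball q ((gamma_p p + 1) * \<epsilon>) \<Longrightarrow> \<bar>u x - v x\<bar> \<le> c + m * \<phi> x"
  shows "\<bar>mv_operator p \<epsilon> u q - mv_operator p \<epsilon> v q\<bar>
    \<le> c + m * (1/3 * average3 \<phi> \<epsilon> q + 2/3 * C)"
proof -
  let ?r = "gamma_p p * \<epsilon>"
  have r: "0 < ?r" using gamma_p_pos [OF p] \<epsilon> by simp
  have cm: "(\<lambda>x. c + m * \<phi> x) \<in> bcontfun"
    using \<phi> by (intro bcontfun_real_intros)
  have A: "\<bar>average3 u \<epsilon> q' - average3 v \<epsilon> q'\<bar> \<le> c + m * average3 \<phi> \<epsilon> q'"
    if "q' \<in> hball q ?r" for q'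
    unfolding average3_affine [OF \<epsilon> \<phi>, symmetric]
  proof (rule average3_abs_diff_le [OF \<epsilon> u v cm])
    \<comment> \<open>A move of length below \<open>gamma_p p * \<epsilon>\<close> followed by noise
      of length below \<open>\<epsilon>\<close> stays in the larger ball where \<open>le\<close>
      applies.\<close>
    fix x assume "x \<in> hball q' \<epsilon>"
    then show "\<bar>u x - v x\<bar> \<le> c + m * \<phi> x"
      using hball_subset_hball [OF that, of \<epsilon>] by (intro le) (auto simp: distrib_right)
  qed
  have AC: "\<bar>average3 u \<epsilon> q' - average3 v \<epsilon> q'\<bar> \<le> c + m * C" if "q' \<in> hball q ?r" for q'
  proof -
    have "m * average3 \<phi> \<epsilon> q' \<le> m * C"
      using average3_le_const [OF \<epsilon> \<phi> C] m by (rule mult_left_mono)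
    then show ?thesis using A [OF that] by linarith
  qed
  note ne = hball_nonempty [OF r]
  note bu = bdd_image_bcontfun [OF average3_bcontfun [OF \<epsilon> u]]
  note bv = bdd_image_bcontfun [OF average3_bcontfun [OF \<epsilon> v]]
  have S: "\<bar>(SUP q'\<in>hball q ?r. average3 u \<epsilon> q') - (SUP q'\<in>hball q ?r. average3 v \<epsilon> q')\<bar> \<le> c + m * C"
    using AC by (intro abs_SUP_diff_le ne bu bv) auto
  have I: "\<bar>(INF q'\<in>hball q ?r. average3 u \<epsilon> q') - (INF q'\<in>hball q ?r. average3 v \<epsilon> q')\<bar> \<le> c + m * C"
    using AC by (intro abs_INF_diff_le ne bu bv) auto
  have "\<bar>average3 u \<epsilon> q - average3 v \<epsilon> q\<bar> \<le> c + m * average3 \<phi> \<epsilon> q"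
    using r by (intro A) auto
  with S I show ?thesis
    unfolding mv_operator_def by (simp add: algebra_simps abs_le_iff)
qed

text \<open>The set is open and contains \<open>(3/4, 0, 0)\<close>, so the noise charges it. It
  drives the barrier: with positive probability the noise raises the first coordinate by more than
  \<open>\<epsilon> / 2\<close>.\<close>

lemma noise_first_coordinate: "0 < measure noise {w \<in> hball 0 1. 1/2 < fst w}"
proof -
  let ?A = "{w \<in> hball 0 1. 1/2 < fst w} :: heis set"
  have o: "open ?A"
  proof -
    have "?A = hball 0 1 \<inter> {w. 1/2 < fst w}" by auto
    then show ?thesis
      by (auto intro!: open_Int open_hball open_Collect_less continuous_intros)
  qed
  have "koranyi (3/4, 0, 0) = sqrt (sqrt ((9/16)\<^sup>2))"
    by (simp add: koranyi_Pair cmod_def power2_eq_square)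
  also have "\<dots> = 3/4"
    by (simp only: real_sqrt_abs) (simp add: real_sqrt_divide)
  finally have "(3/4, 0, 0) \<in> ?A"
    by simp
  then have "0 < emeasure lborel ?A"
    using emeasure_open_pos [OF o] by blast
  moreover have "emeasure lborel ?A < \<infinity>"
    by (rule emeasure_bounded_finite [OF bounded_subset [OF bounded_hball_zero]]) auto
  ultimately have pos: "0 < measure lborel ?A"
    by (simp add: measure_def enn2real_positive_iff)
  have Ab [measurable]: "?A \<in> sets borel" by (rule borel_open [OF o])
  have "?A \<in> sets noise"
    unfolding sets_noise sets_restrict_space
    by (rule image_eqI [where x = ?A]) (use Ab in auto)
  then have "measure noise ?A = (LINT w|noise. indicator ?A w)"
    by (simp add: Int_absorb2 subset_eq)
  also have "\<dots> = (LINT w:hball 0 1|lborel. indicator ?A w) / measure lborel (hball 0 1)"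
    by (rule integral_noise [OF borel_measurable_indicator [OF Ab]])
  also have "(LINT w:hball 0 1|lborel. indicator ?A w) = (LINT w|lborel. (indicator ?A w :: real))"
    unfolding set_lebesgue_integral_def
    by (rule Bochner_Integration.integral_cong) (auto simp: indicator_def)
  also have "\<dots> = measure lborel ?A" by simp
  finally show ?thesis
    using pos measure_hball_zero_pos by simp
qed

text \<open>Replacing the supremum by the global bound \<open>C\<close> makes the condition linear
  in \<open>\<phi>\<close> and independent of all moves. It is asked on \<open>D\<close> only
  because the cutoff vanishes elsewhere. The normalisation \<open>1 \<le> \<phi> q\<close> permits
  division by \<open>\<phi>\<close> and lets \<open>\<phi>\<close> dominate indicators.\<close>

definition is_barrier :: "heis set \<Rightarrow> real \<Rightarrow> (heis \<Rightarrow> real) \<Rightarrow> real \<Rightarrow> real \<Rightarrow> bool" where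
  "is_barrier D \<epsilon> \<phi> \<theta> C \<longleftrightarrow> \<phi> \<in> bcontfun \<and> 0 < \<theta> \<and> \<theta> < 1 \<and> (\<forall>q. 1 \<le> \<phi> q \<and> \<phi> q \<le> C) \<and>
    (\<forall>q\<in>D. 1/3 * average3 \<phi> \<epsilon> q + 2/3 * C \<le> \<theta> * \<phi> q)"

text \<open>With \<open>\<phi> = C - E\<close> for an exponential \<open>E\<close> in the first coordinate, so steep that averaging multiplies
  it by at least \<open>6\<close> on \<open>D\<close>, the left-hand side is at most \<open>C - 2 E = \<phi> - E\<close>.\<close>

lemma ex_barrier:
  assumes D: "bounded D" and \<epsilon>: "0 < \<epsilon>" "\<epsilon> < 1"
  shows "\<exists>\<phi> \<theta> C. is_barrier D \<epsilon> \<phi> \<theta> C"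
proof -
  let ?A = "{w \<in> hball 0 1. 1/2 < fst w} :: heis set"
  define a where "a = measure noise ?A"
  have a: "0 < a" "a \<le> 1"
    unfolding a_def using noise_first_coordinate by auto
  obtain B where B: "0 < B" "\<And>q. q \<in> D \<Longrightarrow> norm q \<le> B"
    using D by (auto simp: bounded_pos)
  \<comment> \<open>Capping the first coordinate at \<open>R\<close> keeps \<open>E\<close> bounded.
    From a point of \<open>D\<close> one noise step raises that coordinate to at most
    \<open>B + 1\<close>, so the cap is not felt there.\<close>
  define R where "R = B + 1"
  \<comment> \<open>A gain of \<open>\<epsilon> / 2\<close> with probability \<open>a\<close> must
    multiply \<open>E\<close> by 6 on average: a factor 3 would only balance the weight
    \<open>1/3\<close> of the noise term, and 6 leaves a full \<open>E q\<close> to spare.\<close>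
  define l where "l = 2 / \<epsilon> * ln (6 / a)"
  have l: "0 < l" "a * exp (l * (\<epsilon> / 2)) = 6"
    using a \<epsilon> by (auto simp: l_def)
  define E where "E q = exp (l * min (fst q) R)" for q :: heis
  have E: "0 < E q" "E q \<le> exp (l * R)" for q
    using l by (auto simp: E_def)
  have "continuous_on UNIV E"
    unfolding E_def by (intro continuous_intros)
  then have Eb: "E \<in> bcontfun"
    using E by (intro bcontfun_normI [where b = "exp (l * R)"]) (auto simp: less_imp_le)
  define C where "C = 1 + exp (l * R)"
  \<comment> \<open>\<open>e0\<close> bounds \<open>E\<close> from below on \<open>D\<close>. Since
    \<open>\<phi>\<close> is at most \<open>C\<close>, subtracting \<open>e0\<close> is at least as
    good as multiplying by \<open>1 - e0 / C\<close>, which is the choice of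
    \<open>\<theta>\<close>.\<close>
  define e0 where "e0 = exp (- l * R)"
  define \<phi> where "\<phi> q = C + (- 1) * E q" for q
  define \<theta> where "\<theta> = 1 - e0 / C"
  have \<phi>: "1 \<le> \<phi> q" "\<phi> q \<le> C" for q
    using E [of q] by (auto simp: \<phi>_def C_def)
  have C1: "1 < C" by (simp add: C_def)
  have e0: "0 < e0" "e0 \<le> 1"
    using l B by (auto simp: e0_def R_def)
  have \<theta>: "0 < \<theta>" "\<theta> < 1"
    using e0 C1 by (auto simp: \<theta>_def field_simps)
  have "1/3 * average3 \<phi> \<epsilon> q + 2/3 * C \<le> \<theta> * \<phi> q" if q: "q \<in> D" for q
  proof -
    have fq: "\<bar>fst q\<bar> \<le> B"
      using norm_fst_le [of "fst q" "snd q"] B(2) [OF q] by simp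
    have sA: "?A \<in> sets noise"
      using noise_first_coordinate measure_notin_sets by fastforce
    have fst_step: "fst (q \<star> dilation \<epsilon> w) = fst q + \<epsilon> * fst w" for w
      by (cases q, cases w) simp
    have "6 * E q = a * (E q * exp (l * (\<epsilon> / 2)))"
      using l(2) by (simp add: mult.left_commute mult.commute)
    also have "\<dots> = (LINT w|noise. indicator ?A w * (E q * exp (l * (\<epsilon> / 2))))"
      using sA by (simp add: a_def Int_absorb2 subset_eq)
    also have "\<dots> \<le> (LINT w|noise. E (q \<star> dilation \<epsilon> w))"
    proof (rule integral_mono)
      show "integrable noise (\<lambda>w. indicator ?A w * (E q * exp (l * (\<epsilon> / 2))))"
        using sA by (intro integrable_mult_left) (auto simp: noise.emeasure_eq_measure)
      show "integrable noise (\<lambda>w. E (q \<star> dilation \<epsilon> w))"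
        by (rule integrable_noise [OF Eb])
      fix w
      show "indicator ?A w * (E q * exp (l * (\<epsilon> / 2))) \<le> E (q \<star> dilation \<epsilon> w)"
      proof (cases "w \<in> ?A")
        case True
        have w: "1/2 < fst w" "fst w < 1"
          using True abs_fst_le_koranyi [of w] by auto
        have "\<epsilon> * (1/2) \<le> \<epsilon> * fst w" "\<epsilon> * fst w \<le> 1 * 1"
          using w \<epsilon> by (intro mult_left_mono mult_mono; simp)+
        then have "l * (fst q + \<epsilon> / 2) \<le> l * min (fst q + \<epsilon> * fst w) R"
          using fq l by (intro mult_left_mono) (auto simp: R_def)
        moreover have "min (fst q) R = fst q"
          using fq by (simp add: R_def)
        ultimately show ?thesis
          using True by (simp add: E_def fst_step exp_add [symmetric] ring_distribs)
      qed (simp add: E less_imp_le)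
    qed
    also have "\<dots> = average3 E \<epsilon> q"
      by (rule average3_noise [OF \<epsilon>(1) Eb, symmetric])
    finally have "6 * E q \<le> average3 E \<epsilon> q" .
    moreover have "average3 \<phi> \<epsilon> q = C + (- 1) * average3 E \<epsilon> q"
      unfolding \<phi>_def by (rule average3_affine [OF \<epsilon>(1) Eb])
    ultimately have "1/3 * average3 \<phi> \<epsilon> q + 2/3 * C \<le> \<phi> q - E q"
      unfolding \<phi>_def by linarith
    also have "\<dots> \<le> \<phi> q - e0"
    proof -
      have "- R \<le> min (fst q) R" using fq B by (simp add: R_def)
      then have "l * - R \<le> l * min (fst q) R" using l by (intro mult_left_mono) auto
      then show ?thesis by (simp add: e0_def E_def)
    qed
    also have "\<dots> \<le> \<theta> * \<phi> q"
    proof -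
      have "e0 / C * \<phi> q \<le> e0 / C * C"
        using \<phi>(2) [of q] e0 C1 by (intro mult_left_mono) auto
      then show ?thesis using C1 by (simp add: \<theta>_def left_diff_distrib)
    qed
    finally show ?thesis .
  qed
  moreover have "\<phi> \<in> bcontfun"
    unfolding \<phi>_def by (intro bcontfun_real_intros Eb)
  ultimately show ?thesis
    unfolding is_barrier_def using \<theta> \<phi> by blast
qed

section \<open>Existence and uniqueness of solutions\<close>

definition mv_fixpoint_map :: "real \<Rightarrow> heis set \<Rightarrow> (heis \<Rightarrow> real) \<Rightarrow> real \<Rightarrow> (heis \<Rightarrow> real) \<Rightarrow> heis \<Rightarrow> real" where
  "mv_fixpoint_map p D F \<epsilon> u q =
    d_cut D \<epsilon> q * mv_operator p \<epsilon> u q + (1 - d_cut D \<epsilon> q) * F q"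

lemma bdd_cont_solution_iff:
  "bdd_cont_solution p D F \<epsilon> u \<longleftrightarrow> u \<in> bcontfun \<and> u = mv_fixpoint_map p D F \<epsilon> u"
  by (auto simp: bdd_cont_solution_def bcontfun_iff solves_mve_iff mv_fixpoint_map_def fun_eq_iff)

lemma d_cut_bcontfun:
  assumes "bounded D" "0 < \<epsilon>"
  shows "d_cut D \<epsilon> \<in> bcontfun"
  using continuous_on_d_cut [OF assms] d_cut_bounds [OF assms]
  by (intro bcontfun_normI [where b = 1]) auto

lemma mv_fixpoint_map_bcontfun:
  assumes "2 < p" "bounded D" "F \<in> bcontfun" "0 < \<epsilon>" "u \<in> bcontfun"
  shows "mv_fixpoint_map p D F \<epsilon> u \<in> bcontfun"
  unfolding mv_fixpoint_map_def using assms
  by (intro bcontfun_real_intros d_cut_bcontfun mv_operator_bcontfun)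

text \<open>In the unknown \<open>u / \<phi>\<close>, with \<open>\<phi>\<close> the barrier, the equation is a fixed point problem for a
  contraction.\<close>

lemma ex1_bdd_cont_solution:
  assumes p: "2 < p" and D: "bounded D" and F: "F \<in> bcontfun" and \<epsilon>: "0 < \<epsilon>" "\<epsilon> < 1"
  shows "\<exists>!u. bdd_cont_solution p D F \<epsilon> u"
proof -
  obtain \<phi> :: "heis \<Rightarrow> real" and \<theta> C where \<phi>: "\<phi> \<in> bcontfun" "0 < \<theta>" "\<theta> < 1"
    "\<And>q. 1 \<le> \<phi> q" "\<And>q. \<phi> q \<le> C"
    and bar: "\<And>q. q \<in> D \<Longrightarrow> 1/3 * average3 \<phi> \<epsilon> q + 2/3 * C \<le> \<theta> * \<phi> q"
    using ex_barrier [OF D \<epsilon>] unfolding is_barrier_def by blast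
  have \<phi>0: "\<phi> q > 0" for q
    using \<phi>(4) [of q] by linarith
  have "continuous_on UNIV (\<lambda>q. 1 / \<phi> q)"
    using \<phi>(1) \<phi>0 by (intro continuous_intros) (auto simp: bcontfun_iff less_imp_neq [symmetric])
  then have inv: "(\<lambda>q. 1 / \<phi> q) \<in> bcontfun"
    using \<phi>(4) \<phi>0 by (intro bcontfun_normI [where b = 1]) (auto simp: abs_of_pos)
  let ?T = "mv_fixpoint_map p D F \<epsilon>"
  define S where "S v q = 1 / \<phi> q * ?T (\<lambda>x. \<phi> x * v x) q" for v q
  have S: "S v \<in> bcontfun" if "v \<in> bcontfun" for v
    unfolding S_def using p D F \<epsilon> \<phi>(1) inv that
    by (intro bcontfun_real_intros mv_fixpoint_map_bcontfun)
  have "dist (Bcontfun (S v)) (Bcontfun (S w)) \<le> \<theta> * dist v w" for v w :: "heis \<Rightarrow>\<^sub>C real"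
  proof (rule dist_bound)
    fix q
    define m where "m = dist v w"
    have m: "0 \<le> m" by (simp add: m_def)
    let ?v = "\<lambda>x. \<phi> x * v x" and ?w = "\<lambda>x. \<phi> x * w x"
    have vw: "?v \<in> bcontfun" "?w \<in> bcontfun"
      by (intro bcontfun_real_intros \<phi>(1) apply_bcontfun)+
    have "\<bar>?v x - ?w x\<bar> \<le> 0 + m * \<phi> x" for x
    proof -
      have "\<bar>?v x - ?w x\<bar> = \<phi> x * \<bar>v x - w x\<bar>"
        using \<phi>0 [of x] by (simp add: abs_mult right_diff_distrib [symmetric])
      also have "\<dots> \<le> \<phi> x * m"
        using \<phi>0 [of x] dist_bounded [of v x w]
        by (intro mult_left_mono) (auto simp: m_def dist_real_def)
      finally show ?thesis by (simp add: mult.commute)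
    qed
    from mv_operator_abs_diff_le [OF p \<epsilon>(1) vw \<phi>(1,5) m this]
    have d: "\<bar>mv_operator p \<epsilon> ?v q - mv_operator p \<epsilon> ?w q\<bar>
        \<le> m * (1/3 * average3 \<phi> \<epsilon> q + 2/3 * C)" by simp
    have "\<bar>?T ?v q - ?T ?w q\<bar> = d_cut D \<epsilon> q * \<bar>mv_operator p \<epsilon> ?v q - mv_operator p \<epsilon> ?w q\<bar>"
      using d_cut_bounds [OF D \<epsilon>(1), of q]
      by (simp add: mv_fixpoint_map_def abs_mult right_diff_distrib [symmetric])
    \<comment> \<open>The barrier inequality is available on \<open>D\<close> only; outside, the
      cutoff is 0 and the two images agree.\<close>
    also have "\<dots> \<le> m * (\<theta> * \<phi> q)"
    proof (cases "q \<in> D")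
      case True
      have "\<bar>mv_operator p \<epsilon> ?v q - mv_operator p \<epsilon> ?w q\<bar> \<le> m * (\<theta> * \<phi> q)"
        using d mult_left_mono [OF bar [OF True] m] by linarith
      then have "d_cut D \<epsilon> q * \<bar>mv_operator p \<epsilon> ?v q - mv_operator p \<epsilon> ?w q\<bar> \<le> 1 * (m * (\<theta> * \<phi> q))"
        using d_cut_bounds [OF D \<epsilon>(1), of q] by (intro mult_mono) auto
      then show ?thesis by simp
    next
      case False
      then show ?thesis
        using \<phi>0 [of q] \<phi>(2) m \<epsilon>(1) by (simp add: d_cut_eq_0)
    qed
    finally have "\<bar>?T ?v q - ?T ?w q\<bar> \<le> m * \<theta> * \<phi> q" by (simp add: mult.assoc)
    then have "\<bar>S v q - S w q\<bar> \<le> m * \<theta>"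
      using \<phi>0 [of q] by (simp add: S_def diff_divide_distrib [symmetric] divide_le_eq)
    then show "dist (apply_bcontfun (Bcontfun (S v)) q) (apply_bcontfun (Bcontfun (S w)) q) \<le> \<theta> * dist v w"
      by (simp add: Bcontfun_inverse S apply_bcontfun dist_real_def m_def mult.commute)
  qed
  moreover define G where "G v = Bcontfun (S (apply_bcontfun v))" for v
  ultimately have "\<forall>v w. dist (G v) (G w) \<le> \<theta> * dist v w"
    by (simp only: simp_thms)
  then have "\<exists>!v. G v = v"
    by (rule banach_fix_type [rotated 2]) (use \<phi>(2,3) in simp_all)
  then obtain v where v: "G v = v" and uniq: "\<And>w. G w = w \<Longrightarrow> w = v"
    by blast
  have cancel: "\<phi> q * (1 / \<phi> q * a) = a" "1 / \<phi> q * (\<phi> q * a) = a" for q a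
    using \<phi>0 [of q] by auto
  show ?thesis
  \<comment> \<open>Both \<open>\<phi>\<close> and its reciprocal are bounded and continuous, so
    multiplication by \<open>\<phi>\<close> is a bijection between fixed points of \<open>G\<close>
    and bounded continuous solutions.\<close>
  proof (rule ex1I [of _ "\<lambda>q. \<phi> q * v q"])
    have "apply_bcontfun v = S v"
      using arg_cong [OF v, of apply_bcontfun]
      by (simp only: G_def Bcontfun_inverse [OF S [OF apply_bcontfun]])
    then have "\<phi> q * v q = \<phi> q * S v q" for q
      by (rule arg_cong [where f = "\<lambda>f. \<phi> q * f q"])
    then have eq: "\<phi> q * v q = ?T (\<lambda>q. \<phi> q * v q) q" for q
      unfolding S_def cancel(1) .
    show "bdd_cont_solution p D F \<epsilon> (\<lambda>q. \<phi> q * v q)"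
      unfolding bdd_cont_solution_iff
      by (intro conjI bcontfun_real_intros \<phi>(1) apply_bcontfun ext eq)
  next
    fix u assume "bdd_cont_solution p D F \<epsilon> u"
    then have u: "u \<in> bcontfun" "u = ?T u" by (auto simp: bdd_cont_solution_iff)
    let ?w = "\<lambda>q. 1 / \<phi> q * u q"
    have w: "?w \<in> bcontfun"
      by (intro bcontfun_real_intros inv u(1))
    have "S ?w = ?w"
      unfolding S_def cancel(1) using u(2) by simp
    then have "G (Bcontfun ?w) = Bcontfun ?w"
      by (simp only: G_def Bcontfun_inverse [OF w])
    from uniq [OF this] have "apply_bcontfun (Bcontfun ?w) = apply_bcontfun v"
      by (rule arg_cong)
    then have "?w = apply_bcontfun v"
      by (simp only: Bcontfun_inverse [OF w])
    then have "1 / \<phi> q * u q = v q" for q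
      by (rule fun_cong)
    then have "\<phi> q * (1 / \<phi> q * u q) = \<phi> q * v q" for q
      by (simp only:)
    then show "u = (\<lambda>q. \<phi> q * v q)"
      unfolding cancel(1) by (rule ext)
  qed
qed

text \<open>Unique existence is what gives the definite description in \<open>u_eps\<close> its
  meaning.\<close>

lemma u_eps_solution:
  assumes "2 < p" "bounded D" "F \<in> bcontfun" "0 < \<epsilon>" "\<epsilon> < 1"
  shows "bdd_cont_solution p D F \<epsilon> (u_eps p D F \<epsilon>)"
  unfolding u_eps_def by (rule theI' [OF ex1_bdd_cont_solution [OF assms]])

text \<open>Negation exchanges infimum and supremum, which carry equal weights. Lower bounds for
  solutions thus follow from upper bounds.\<close>

lemma bdd_cont_solution_uminus:
  assumes "0 < \<epsilon>" "bdd_cont_solution p D F \<epsilon> u"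
  shows "bdd_cont_solution p D (\<lambda>q. - F q) \<epsilon> (\<lambda>q. - u q)"
proof -
  have u: "u \<in> bcontfun" "u q = mv_fixpoint_map p D F \<epsilon> u q" for q
    using assms(2) unfolding bdd_cont_solution_iff by metis+
  have "- u q = mv_fixpoint_map p D (\<lambda>q. - F q) \<epsilon> (\<lambda>q. - u q) q" for q
  proof -
    have "- u q = - mv_fixpoint_map p D F \<epsilon> u q"
      by (rule arg_cong [OF u(2)])
    then show ?thesis
      by (simp add: mv_fixpoint_map_def mv_operator_uminus [OF assms(1) u(1)])
  qed
  then show ?thesis
    unfolding bdd_cont_solution_iff by (intro conjI bcontfun_real_intros u(1) ext)
qed

lemma bcontfun_left_translate:
  fixes u :: "heis \<Rightarrow> real"
  assumes u: "u \<in> bcontfun"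
  shows "(\<lambda>x. u (g \<star> x)) \<in> bcontfun"
proof -
  have "continuous_on UNIV (\<lambda>x. u (g \<star> x))"
    by (rule continuous_on_compose2 [of UNIV u])
      (use u in \<open>auto simp: bcontfun_iff intro!: continuous_intros\<close>)
  moreover have "bounded (range (\<lambda>x. u (g \<star> x)))"
    using u by (auto simp: bcontfun_iff intro!: bounded_subset [of "range u"])
  ultimately show ?thesis
    by (simp add: bcontfun_iff)
qed

text \<open>Balls and averages are parametrised by right multiplication, so associativity moves
  \<open>g\<close> past both.\<close>

lemma mv_operator_left_translate:
  assumes p: "2 < p" and \<epsilon>: "0 < \<epsilon>" and u: "u \<in> bcontfun"
  shows "mv_operator p \<epsilon> (\<lambda>x. u (g \<star> x)) q = mv_operator p \<epsilon> u (g \<star> q)"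
proof -
  have r: "0 < gamma_p p * \<epsilon>" using gamma_p_pos [OF p] \<epsilon> by simp
  have A: "average3 (\<lambda>x. u (g \<star> x)) \<epsilon> x = average3 u \<epsilon> (g \<star> x)" for x
    by (simp add: average3_noise [OF \<epsilon>] u bcontfun_left_translate [OF u] hmult_assoc)
  show ?thesis
    by (simp add: mv_operator_def A hball_eq_image [OF r] image_image hmult_assoc)
qed

section \<open>One step of the game\<close>

lemma borel_measurable_hmult [measurable (raw)]:
  assumes "f \<in> M \<rightarrow>\<^sub>M borel" "g \<in> M \<rightarrow>\<^sub>M borel"
  shows "(\<lambda>x. f x \<star> g x) \<in> M \<rightarrow>\<^sub>M borel"
  using assms
  by (rule borel_measurable_continuous_Pair [where H = "(\<star>)"]) (intro continuous_intros)

lemma borel_measurable_dilation [measurable (raw)]: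
  assumes f: "f \<in> M \<rightarrow>\<^sub>M borel"
  shows "(\<lambda>x. dilation r (f x)) \<in> M \<rightarrow>\<^sub>M borel"
proof -
  have "dilation r \<in> borel \<rightarrow>\<^sub>M borel"
    by (intro borel_measurable_continuous_onI continuous_intros)
  then show ?thesis
    by (rule measurable_compose [OF f])
qed

section \<open>The outcome of one round\<close>

lemma prob_space_choice: "prob_space (uniform_count_measure {1, 2, 3 :: nat})"
  by (rule prob_space_uniform_count_measure) auto

lemma prob_space_threshold: "prob_space (restrict_space lborel {0<..<1 :: real})"
  by (intro prob_space_restrict_space) auto

lemma prob_space_Omega1: "prob_space Omega1"
proof -
  interpret c: prob_space "uniform_count_measure {1, 2, 3 :: nat}"
    by (rule prob_space_choice)
  interpret t: prob_space "restrict_space lborel {0<..<1 :: real}"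
    by (rule prob_space_threshold)
  interpret ct: pair_prob_space "uniform_count_measure {1, 2, 3 :: nat}"
    "restrict_space lborel {0<..<1 :: real}" ..
  interpret all: pair_prob_space noise
    "uniform_count_measure {1, 2, 3 :: nat} \<Otimes>\<^sub>M restrict_space lborel {0<..<1 :: real}" ..
  show ?thesis
    unfolding Omega1_def noise_def [symmetric] by (rule all.prob_space_axioms)
qed

interpretation Omega1: prob_space Omega1
  by (rule prob_space_Omega1)

lemma prob_space_Omega: "prob_space Omega"
  unfolding Omega_def by (intro prob_space_PiM prob_space_Omega1)

interpretation Omega: prob_space Omega
  by (rule prob_space_Omega)

lemma measurable_outcome [measurable]:
  shows "fst \<in> Omega1 \<rightarrow>\<^sub>M borel"
    and "(\<lambda>x. fst (snd x)) \<in> Omega1 \<rightarrow>\<^sub>M count_space UNIV"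
    and "(\<lambda>x. snd (snd x)) \<in> Omega1 \<rightarrow>\<^sub>M borel"
proof -
  let ?C = "uniform_count_measure {1, 2, 3 :: nat}" and ?T = "restrict_space lborel {0<..<1 :: real}"
  have n: "(\<lambda>w. w) \<in> noise \<rightarrow>\<^sub>M borel"
    by (intro borel_measurable_noise) simp
  have c: "(\<lambda>s. s) \<in> ?C \<rightarrow>\<^sub>M count_space UNIV"
    by (rule measurableI) (auto simp: sets_uniform_count_measure space_uniform_count_measure)
  have t: "(\<lambda>t. t) \<in> ?T \<rightarrow>\<^sub>M borel"
    by (intro measurable_restrict_space1) simp
  have e: "Omega1 = noise \<Otimes>\<^sub>M (?C \<Otimes>\<^sub>M ?T)"
    by (simp add: Omega1_def noise_def)
  show "fst \<in> Omega1 \<rightarrow>\<^sub>M borel"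
    unfolding e using measurable_compose [OF measurable_fst n] by simp
  show "(\<lambda>x. fst (snd x)) \<in> Omega1 \<rightarrow>\<^sub>M count_space UNIV"
    unfolding e by (rule measurable_compose [OF measurable_compose [OF measurable_snd measurable_fst] c])
  show "(\<lambda>x. snd (snd x)) \<in> Omega1 \<rightarrow>\<^sub>M borel"
    unfolding e by (rule measurable_compose [OF measurable_compose [OF measurable_snd measurable_snd] t])
qed

text \<open>The product runs over indices from 1 on; coordinate 0 carries no outcome.\<close>

lemma measurable_outcome_at:
  "1 \<le> k \<Longrightarrow> (\<lambda>\<omega>. \<omega> k) \<in> Omega \<rightarrow>\<^sub>M Omega1"
  unfolding Omega_def by (rule measurable_component_singleton) simp

text \<open>Conditioning on all coordinates but the \<open>i\<close>-th.\<close>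

lemma Omega_integral_ge_resampled:
  fixes \<Psi> :: "(nat \<Rightarrow> outcome1) \<Rightarrow> real"
  assumes meas: "\<Psi> \<in> borel_measurable Omega" and bnd: "\<And>\<omega>. \<bar>\<Psi> \<omega>\<bar> \<le> K"
    and i: "1 \<le> i"
    and ge: "\<And>\<omega>. \<omega> \<in> space Omega \<Longrightarrow> c \<le> (LINT x|Omega1. \<Psi> (fun_upd \<omega> i x))"
  shows "c \<le> (LINT \<omega>|Omega. \<Psi> \<omega>)"
proof -
  define I where "I = {1..} - {i}"
  let ?P = "\<Pi>\<^sub>M j\<in>I. Omega1"
  interpret P: prob_space ?P
    by (intro prob_space_PiM prob_space_Omega1)
  interpret pair: pair_prob_space Omega1 ?P ..
  have I: "{1..} = insert i I" using i by (auto simp: I_def)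
  \<comment> \<open>Reinserting an independent outcome at \<open>i\<close> reproduces the measure,
    so the integral becomes an iterated one with the resampled coordinate inside.\<close>
  have eq: "distr (Omega1 \<Otimes>\<^sub>M ?P) Omega (\<lambda>(x, X). X(i := x)) = Omega"
    using distr_pair_PiM_eq_PiM [where M = "\<lambda>_. Omega1" and I = I and i' = i]
    unfolding Omega_def I by (simp add: prob_space_Omega1)
  have m: "(\<lambda>(x, X). X(i := x)) \<in> Omega1 \<Otimes>\<^sub>M ?P \<rightarrow>\<^sub>M Omega"
    unfolding Omega_def I by measurable
  have mc: "(\<lambda>(x, X). \<Psi> (fun_upd X i x)) \<in> borel_measurable (Omega1 \<Otimes>\<^sub>M ?P)"
    using measurable_compose [OF m meas] by (simp add: case_prod_beta')
  have int: "integrable (Omega1 \<Otimes>\<^sub>M ?P) (\<lambda>(x, X). \<Psi> (fun_upd X i x))"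
    by (rule pair.integrable_const_bound [where B = K, OF _ mc]) (auto simp: bnd)
  have "c = (LINT X|?P. c)"
    by (simp add: P.prob_space)
  also have "\<dots> \<le> (LINT X|?P. (LINT x|Omega1. \<Psi> (fun_upd X i x)))"
  proof (rule integral_mono)
    show "integrable ?P (\<lambda>X. LINT x|Omega1. \<Psi> (fun_upd X i x))"
      using pair.integrable_snd [OF int] .
    fix X assume X: "X \<in> space ?P"
    \<comment> \<open>\<open>X\<close> has no coordinate \<open>i\<close> and so is not a point of
      \<open>Omega\<close>. Any filler \<open>x\<close> makes it one, and the update inside the
      integral overwrites the filler.\<close>
    obtain x where x: "x \<in> space Omega1"
      using Omega1.not_empty by blast
    have "X(i := x) \<in> space Omega"
      using measurable_space [OF m, of "(x, X)"] x X by (simp add: space_pair_measure)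
    from ge [OF this] show "c \<le> (LINT x|Omega1. \<Psi> (fun_upd X i x))"
      by simp
  qed simp
  also have "\<dots> = (LINT (x, X)|(Omega1 \<Otimes>\<^sub>M ?P). \<Psi> (fun_upd X i x))"
    using pair.integral_snd [OF int] .
  also have "\<dots> = (LINT \<omega>|(distr (Omega1 \<Otimes>\<^sub>M ?P) Omega (\<lambda>(x, X). X(i := x))). \<Psi> \<omega>)"
    by (subst integral_distr [OF m meas]) (simp add: case_prod_beta')
  finally show ?thesis
    unfolding eq .
qed

text \<open>The moves enter as fixed vectors: given the past they are constants, and only the
  outcome \<open>x\<close> is random.\<close>

definition game_step :: "real \<Rightarrow> real \<Rightarrow> heis \<Rightarrow> heis \<Rightarrow> heis \<Rightarrow> outcome1 \<Rightarrow> heis" where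
  "game_step p \<epsilon> q a b x =
    (if fst (snd x) = 1 then q \<star> dilation (gamma_p p * \<epsilon>) a \<star> dilation \<epsilon> (fst x)
     else if fst (snd x) = 2 then q \<star> dilation (gamma_p p * \<epsilon>) b \<star> dilation \<epsilon> (fst x)
     else q \<star> dilation \<epsilon> (fst x))"

text \<open>Comparison with a uniform threshold turns the cutoff value into the probability of
  playing on.\<close>

lemma integral_threshold:
  fixes a c d :: real
  assumes "0 \<le> d" "d \<le> 1"
  shows "(LINT t|restrict_space lborel {0<..<1}. (if t \<le> d then a else c)) = d * a + (1 - d) * c"
proof -
  let ?T = "restrict_space lborel {0<..<1 :: real}"
  interpret t: prob_space ?T by (rule prob_space_threshold)
  have S: "{0<..<1} \<inter> {..d} \<in> sets ?T"
    by (simp add: sets_restrict_space)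
  have "(LINT t|?T. (if t \<le> d then a else c))
      = (LINT t|?T. c + (a - c) * indicator ({0<..<1} \<inter> {..d}) t)"
    by (rule Bochner_Integration.integral_cong) (auto simp: space_restrict_space)
  also have "\<dots> = c + (a - c) * measure ?T ({0<..<1} \<inter> {..d})"
  proof -
    have sp: "space ?T = {0<..<1}" by (simp add: space_restrict_space)
    have one: "measure ?T {0<..<1} = 1" using t.prob_space by (simp add: sp)
    have "{0<..<1} \<inter> {..d} \<inter> {0<..<1} = {0<..<1} \<inter> {..d}" by auto
    then show ?thesis
      using S by (subst Bochner_Integration.integral_add)
        (auto simp: sp one t.emeasure_eq_measure intro!: integrable_mult_right)
  qed
  also have "measure ?T ({0<..<1} \<inter> {..d}) = measure lborel ({0<..<1} \<inter> {..d})"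
    by (rule measure_restrict_space) auto
  also have "\<dots> = d"
  proof (cases "d < 1")
    case True
    have "{0<..<1} \<inter> {..d} = {0<..d}" using True by auto
    then show ?thesis using assms by simp
  next
    case False
    then have "{0<..<1} \<inter> {..d} = {0<..<1}" "d = 1" using assms by auto
    then show ?thesis by simp
  qed
  finally show ?thesis by (simp add: algebra_simps)
qed

lemma integral_choice:
  fixes f :: "nat \<Rightarrow> real"
  shows "(LINT s|uniform_count_measure {1, 2, 3}. f s) = (f 1 + f 2 + f 3) / 3"
proof -
  have "(LINT s|uniform_count_measure {1, 2, 3}. f s) = (LINT s|point_measure {1, 2, 3} (\<lambda>_. ennreal (1/3)). f s)"
    by (simp add: uniform_count_measure_def divide_ennreal [symmetric])
  also have "\<dots> = (f 1 + f 2 + f 3) / 3"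
    by (subst lebesgue_integral_point_measure_finite) auto
  finally show ?thesis .
qed

text \<open>Fubini over noise, choice and threshold. If the two moves realised the infimum and the
  supremum of the averages, the result with \<open>d\<close> the cutoff and \<open>c\<close> the
  boundary value would be the right-hand side of the mean value equation.\<close>

lemma integral_game_step:
  fixes g :: "heis \<Rightarrow> real"
  assumes g: "g \<in> bcontfun" and d: "0 \<le> d" "d \<le> 1" and \<epsilon>: "0 < \<epsilon>"
  shows "(LINT x|Omega1. (if snd (snd x) \<le> d then g (game_step p \<epsilon> q a b x) else c))
    = d * ((average3 g \<epsilon> (q \<star> dilation (gamma_p p * \<epsilon>) a)
        + average3 g \<epsilon> (q \<star> dilation (gamma_p p * \<epsilon>) b) + average3 g \<epsilon> q) / 3) + (1 - d) * c"
proof -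
  let ?C = "uniform_count_measure {1, 2, 3 :: nat}" and ?T = "restrict_space lborel {0<..<1 :: real}"
  let ?f = "\<lambda>x. if snd (snd x) \<le> d then g (game_step p \<epsilon> q a b x) else c"
  interpret c: prob_space ?C by (rule prob_space_choice)
  interpret t: prob_space ?T by (rule prob_space_threshold)
  interpret ct: pair_prob_space ?C ?T ..
  interpret all: pair_prob_space noise "?C \<Otimes>\<^sub>M ?T" ..
  have e: "Omega1 = noise \<Otimes>\<^sub>M (?C \<Otimes>\<^sub>M ?T)"
    by (simp add: Omega1_def noise_def)
  obtain K where K: "0 < K" "\<And>x. \<bar>g x\<bar> \<le> K" using bcontfun_bound [OF g] by blast
  note [measurable] = bcontfun_borel_measurable [OF g]
  have mf: "?f \<in> borel_measurable Omega1"
    unfolding game_step_def by measurable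
  have bf: "\<bar>?f x\<bar> \<le> K + \<bar>c\<bar>" for x
    using K(1) K(2) [of "game_step p \<epsilon> q a b x"] by auto
  have intf: "integrable (noise \<Otimes>\<^sub>M (?C \<Otimes>\<^sub>M ?T)) ?f"
    using mf unfolding e by (rule all.integrable_const_bound [where B = "K + \<bar>c\<bar>", rotated]) (simp add: bf)
  define G where "G w s = (if s = 1 then g (q \<star> dilation (gamma_p p * \<epsilon>) a \<star> dilation \<epsilon> w)
     else if s = 2 then g (q \<star> dilation (gamma_p p * \<epsilon>) b \<star> dilation \<epsilon> w)
     else g (q \<star> dilation \<epsilon> w))" for w and s :: nat
  have inner: "(LINT y|(?C \<Otimes>\<^sub>M ?T). ?f (w, y)) = (LINT s|?C. LINT t|?T. (if t \<le> d then G w s else c))"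
    if w: "w \<in> space noise" for w
  proof -
    have "(\<lambda>y. ?f (w, y)) \<in> borel_measurable (?C \<Otimes>\<^sub>M ?T)"
      using mf unfolding e by (rule measurable_Pair2) (fact w)
    then have "integrable (?C \<Otimes>\<^sub>M ?T) (\<lambda>y. ?f (w, y))"
      by (rule ct.integrable_const_bound [where B = "K + \<bar>c\<bar>", rotated])
        (intro AE_I2, simp only: real_norm_def, rule bf)
    from ct.integral_fst' [OF this]
    have "(LINT y|(?C \<Otimes>\<^sub>M ?T). ?f (w, y)) = (LINT s|?C. LINT t|?T. ?f (w, s, t))"
      by (rule sym)
    then show ?thesis
      by (simp add: G_def game_step_def if_distrib [of g] cong: if_cong)
  qed
  have "(LINT x|Omega1. ?f x) = (LINT w|noise. LINT y|(?C \<Otimes>\<^sub>M ?T). ?f (w, y))"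
    unfolding e by (rule all.integral_fst' [OF intf, symmetric])
  also have "\<dots> = (LINT w|noise. LINT s|?C. LINT t|?T. (if t \<le> d then G w s else c))"
    by (rule Bochner_Integration.integral_cong [OF refl inner])
  also have "\<dots> = (LINT w|noise. d * ((g (q \<star> dilation (gamma_p p * \<epsilon>) a \<star> dilation \<epsilon> w)
      + g (q \<star> dilation (gamma_p p * \<epsilon>) b \<star> dilation \<epsilon> w) + g (q \<star> dilation \<epsilon> w)) / 3) + (1 - d) * c)"
    by (simp only: integral_threshold [OF d] integral_choice) (simp add: G_def field_simps)
  also have "\<dots> = d * ((average3 g \<epsilon> (q \<star> dilation (gamma_p p * \<epsilon>) a)
        + average3 g \<epsilon> (q \<star> dilation (gamma_p p * \<epsilon>) b) + average3 g \<epsilon> q) / 3) + (1 - d) * c"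
    using integrable_noise [OF g] noise.prob_space by (simp add: average3_noise [OF \<epsilon> g])
  finally show ?thesis .
qed

section \<open>The game\<close>

locale tug_of_war =
  fixes p :: real and \<epsilon> :: real and D :: "heis set" and q0 :: heis and \<sigma>I \<sigma>II :: strategy
  assumes p: "2 < p" and \<epsilon>: "0 < \<epsilon>" "\<epsilon> < 1" and D: "bounded D"
    and \<sigma>I: "is_strategy \<sigma>I" and \<sigma>II: "is_strategy \<sigma>II"
begin

section \<open>Positions and histories as random variables\<close>

abbreviation Q :: "nat \<Rightarrow> (nat \<Rightarrow> outcome1) \<Rightarrow> heis" where
  "Q \<equiv> position p \<epsilon> q0 \<sigma>I \<sigma>II"

definition hist :: "nat \<Rightarrow> (nat \<Rightarrow> outcome1) \<Rightarrow> history" where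
  "hist n \<omega> = (q0, \<lambda>k\<in>{1..n}. (Q k \<omega>, \<omega> k))"

lemma Q_Suc:
  "Q (Suc n) \<omega> = game_step p \<epsilon> (Q n \<omega>) (\<sigma>I n (hist n \<omega>)) (\<sigma>II n (hist n \<omega>)) (\<omega> (Suc n))"
  by (simp add: game_step_def hist_def Let_def case_prod_beta')

declare position.simps(2) [simp del]

text \<open>Adaptedness: the first \<open>n\<close> outcomes determine \<open>Q n\<close>. The
  induction is strong because a move depends on all earlier positions through the history.\<close>

lemma Q_cong: "(\<And>k. k \<in> {1..n} \<Longrightarrow> \<omega> k = \<omega>' k) \<Longrightarrow> Q n \<omega> = Q n \<omega>'"
proof (induction n rule: less_induct)
  case (less n)
  show ?case
  proof (cases n)
    case (Suc m)
    have "Q k \<omega> = Q k \<omega>'" if "k \<le> m" for k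
      using that Suc by (intro less.IH less.prems) auto
    moreover have "\<omega> k = \<omega>' k" if "1 \<le> k" "k \<le> Suc m" for k
      using that Suc by (intro less.prems) auto
    ultimately have "Q m \<omega> = Q m \<omega>'" "hist m \<omega> = hist m \<omega>'" "\<omega> (Suc m) = \<omega>' (Suc m)"
      by (auto simp: hist_def intro!: restrict_ext)
    then show ?thesis
      by (simp only: Suc Q_Suc)
  qed simp
qed

lemma hist_cong:
  assumes "\<And>k. k \<in> {1..n} \<Longrightarrow> \<omega> k = \<omega>' k"
  shows "hist n \<omega> = hist n \<omega>'"
  unfolding hist_def using assms by (intro arg_cong [of _ _ "Pair q0"] restrict_ext) (auto intro!: Q_cong)

text \<open>Histories contain positions and positions depend on histories. Taking the positions as
  hypothesis makes this half usable inside the induction for \<open>measurable_Q\<close>.\<close>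

lemma measurable_hist_aux:
  assumes "\<And>k. k \<le> n \<Longrightarrow> Q k \<in> Omega \<rightarrow>\<^sub>M borel"
  shows "hist n \<in> Omega \<rightarrow>\<^sub>M histories n"
  unfolding hist_def histories_def
  using assms by (intro measurable_Pair measurable_restrict measurable_outcome_at) auto

lemma measurable_move_aux:
  assumes "is_strategy \<sigma>" "hist n \<in> Omega \<rightarrow>\<^sub>M histories n"
  shows "(\<lambda>\<omega>. \<sigma> n (hist n \<omega>)) \<in> Omega \<rightarrow>\<^sub>M borel"
proof -
  have "\<sigma> n \<in> histories n \<rightarrow>\<^sub>M restrict_space borel (hball 0 1)"
    using assms(1) by (simp add: is_strategy_def)
  then have "\<sigma> n \<in> histories n \<rightarrow>\<^sub>M borel"
    by (simp add: measurable_restrict_space2_iff)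
  from measurable_compose [OF assms(2) this] show ?thesis .
qed

lemma measurable_Q [measurable]: "Q n \<in> Omega \<rightarrow>\<^sub>M borel"
proof (induction n rule: less_induct)
  case (less n)
  show ?case
  proof (cases n)
    case 0
    then show ?thesis by simp
  next
    case (Suc m)
    have h: "hist m \<in> Omega \<rightarrow>\<^sub>M histories m"
      using less.IH Suc by (intro measurable_hist_aux) auto
    note [measurable] = measurable_move_aux [OF \<sigma>I h] measurable_move_aux [OF \<sigma>II h]
    have [measurable]: "Q m \<in> Omega \<rightarrow>\<^sub>M borel"
      using less.IH Suc by auto
    have [measurable]: "(\<lambda>\<omega>. \<omega> (Suc m)) \<in> Omega \<rightarrow>\<^sub>M Omega1"
      by (rule measurable_outcome_at) simp
    show ?thesis
      unfolding Suc Q_Suc game_step_def by measurable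
  qed
qed

lemma measurable_hist: "hist n \<in> Omega \<rightarrow>\<^sub>M histories n"
  by (rule measurable_hist_aux) (rule measurable_Q)

lemma move_in_hball:
  assumes "is_strategy \<sigma>" "\<omega> \<in> space Omega"
  shows "\<sigma> n (hist n \<omega>) \<in> hball 0 1"
proof -
  have "\<sigma> n \<in> histories n \<rightarrow>\<^sub>M restrict_space borel (hball 0 1)"
    using assms(1) by (simp add: is_strategy_def)
  from measurable_space [OF measurable_compose [OF measurable_hist this] assms(2)]
  show ?thesis by (simp add: space_restrict_space)
qed

text \<open>The event that the stopping time exceeds \<open>n\<close>, written without
  \<open>LEAST\<close> so that it is also correct on paths that never stop.\<close>

definition alive :: "nat \<Rightarrow> (nat \<Rightarrow> outcome1) \<Rightarrow> bool" where
  "alive n \<omega> \<longleftrightarrow> (\<forall>k\<in>{1..n}. snd (snd (\<omega> k)) \<le> d_cut D \<epsilon> (Q (k - 1) \<omega>))"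

lemma alive_0: "alive 0 \<omega>"
  by (simp add: alive_def)

lemma alive_Suc: "alive (Suc n) \<omega> \<longleftrightarrow> alive n \<omega> \<and> snd (snd (\<omega> (Suc n))) \<le> d_cut D \<epsilon> (Q n \<omega>)"
  by (auto simp: alive_def atLeastAtMostSuc_conv)

lemma alive_cong:
  assumes "\<And>k. k \<in> {1..n} \<Longrightarrow> \<omega> k = \<omega>' k"
  shows "alive n \<omega> = alive n \<omega>'"
proof -
  have "Q (k - 1) \<omega> = Q (k - 1) \<omega>'" if "k \<in> {1..n}" for k
    using that by (intro Q_cong assms) auto
  then show ?thesis
    using assms by (simp add: alive_def)
qed

lemma measurable_d_cut: "d_cut D \<epsilon> \<in> borel_measurable borel"
  by (rule borel_measurable_continuous_onI [OF continuous_on_d_cut [OF D \<epsilon>(1)]])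

lemma measurable_d_cut_Q: "(\<lambda>\<omega>. d_cut D \<epsilon> (Q n \<omega>)) \<in> borel_measurable Omega"
  by (rule measurable_compose [OF measurable_Q measurable_d_cut])

lemma measurable_threshold: "1 \<le> k \<Longrightarrow> (\<lambda>\<omega>. snd (snd (\<omega> k))) \<in> borel_measurable Omega"
  by (rule measurable_compose [OF measurable_outcome_at measurable_outcome(3)])

lemma measurable_alive [measurable]: "Measurable.pred Omega (alive n)"
proof (induction n)
  case (Suc n)
  have "Measurable.pred Omega (\<lambda>\<omega>. alive n \<omega> \<and> \<not> d_cut D \<epsilon> (Q n \<omega>) < snd (snd (\<omega> (Suc n))))"
    by (intro pred_intros_logic Suc borel_measurable_pred_less measurable_d_cut_Q
      measurable_threshold) simp
  then show ?case
    unfolding alive_Suc by (simp only: not_less)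
qed (simp add: alive_0)

abbreviation stopped :: "(nat \<Rightarrow> outcome1) \<Rightarrow> heis" where
  "stopped \<equiv> stopped_position p D \<epsilon> q0 \<sigma>I \<sigma>II"

lemma stopped_eq:
  assumes "alive n \<omega>" "\<not> alive (Suc n) \<omega>"
  shows "stopped \<omega> = Q n \<omega>"
proof -
  have "stop_time p D \<epsilon> q0 \<sigma>I \<sigma>II \<omega> = Suc n"
    unfolding stop_time_def
  proof (rule Least_equality)
    show "1 \<le> Suc n \<and> (case \<omega> (Suc n) of (w, s, t) \<Rightarrow> d_cut D \<epsilon> (Q (Suc n - 1) \<omega>) < t)"
      using assms by (simp add: alive_Suc case_prod_beta')
    fix m assume m: "1 \<le> m \<and> (case \<omega> m of (w, s, t) \<Rightarrow> d_cut D \<epsilon> (Q (m - 1) \<omega>) < t)"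
    show "Suc n \<le> m"
    proof (rule ccontr)
      assume "\<not> Suc n \<le> m"
      then have "snd (snd (\<omega> m)) \<le> d_cut D \<epsilon> (Q (m - 1) \<omega>)"
        using assms(1) m by (auto simp: alive_def)
      then show False using m by (simp add: case_prod_beta')
    qed
  qed
  then show ?thesis by (simp add: stopped_position_def)
qed

lemma measurable_stopped: "stopped \<in> Omega \<rightarrow>\<^sub>M borel"
proof -
  have "stop_time p D \<epsilon> q0 \<sigma>I \<sigma>II \<in> Omega \<rightarrow>\<^sub>M count_space UNIV"
    unfolding stop_time_def case_prod_beta'
  proof (rule measurable_Least)
    fix n
    show "Measurable.pred Omega (\<lambda>\<omega>. 1 \<le> n \<and> d_cut D \<epsilon> (Q (n - 1) \<omega>) < snd (snd (\<omega> n)))"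
    proof (cases "1 \<le> n")
      case True
      then show ?thesis
        using borel_measurable_pred_less [OF measurable_d_cut_Q measurable_threshold, of n "n - 1"]
        by simp
    qed simp
  qed
  then have "(\<lambda>\<omega>. Q (stop_time p D \<epsilon> q0 \<sigma>I \<sigma>II \<omega> - 1) \<omega>) \<in> Omega \<rightarrow>\<^sub>M borel"
    by (rule measurable_compose_countable [where f = "\<lambda>n. Q (n - 1)", rotated]) (rule measurable_Q)
  then show ?thesis
    unfolding stopped_position_def .
qed

text \<open>The payoff if the game were stopped with value \<open>g\<close> after \<open>n\<close> steps, and its conditional mean.\<close>

definition payoff :: "(heis \<Rightarrow> real) \<Rightarrow> (heis \<Rightarrow> real) \<Rightarrow> nat \<Rightarrow> (nat \<Rightarrow> outcome1) \<Rightarrow> real" where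
  "payoff g F n \<omega> = (if alive n \<omega> then g (Q n \<omega>) else F (stopped \<omega>))"

definition step_value :: "(heis \<Rightarrow> real) \<Rightarrow> (heis \<Rightarrow> real) \<Rightarrow> nat \<Rightarrow> (nat \<Rightarrow> outcome1) \<Rightarrow> real" where
  "step_value g F n \<omega> = d_cut D \<epsilon> (Q n \<omega>) *
      ((average3 g \<epsilon> (Q n \<omega> \<star> dilation (gamma_p p * \<epsilon>) (\<sigma>I n (hist n \<omega>)))
        + average3 g \<epsilon> (Q n \<omega> \<star> dilation (gamma_p p * \<epsilon>) (\<sigma>II n (hist n \<omega>)))
        + average3 g \<epsilon> (Q n \<omega>)) / 3) + (1 - d_cut D \<epsilon> (Q n \<omega>)) * F (Q n \<omega>)"

lemma measurable_payoff:
  assumes "g \<in> bcontfun" "F \<in> bcontfun"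
  shows "payoff g F n \<in> borel_measurable Omega"
proof -
  note [measurable] = assms [THEN bcontfun_borel_measurable] measurable_stopped
  show ?thesis unfolding payoff_def by measurable
qed

lemma payoff_bounded:
  assumes "g \<in> bcontfun" "F \<in> bcontfun"
  shows "\<exists>K. \<forall>n \<omega>. \<bar>payoff g F n \<omega>\<bar> \<le> K"
proof -
  obtain K where K: "0 < K" "\<And>x. \<bar>g x\<bar> \<le> K" using bcontfun_bound [OF assms(1)] by blast
  obtain L where L: "0 < L" "\<And>x. \<bar>F x\<bar> \<le> L" using bcontfun_bound [OF assms(2)] by blast
  have "\<bar>payoff g F n \<omega>\<bar> \<le> max K L" for n \<omega>
    using K(2) [of "Q n \<omega>"] L(2) [of "stopped \<omega>"] by (simp add: payoff_def le_max_iff_disj)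
  then show ?thesis by blast
qed

lemma integrable_payoff:
  assumes "g \<in> bcontfun" "F \<in> bcontfun"
  shows "integrable Omega (payoff g F n)"
proof -
  obtain K where K: "\<forall>n \<omega>. \<bar>payoff g F n \<omega>\<bar> \<le> K" using payoff_bounded [OF assms] by blast
  then show ?thesis
    by (intro Omega.integrable_const_bound [where B = K] measurable_payoff [OF assms]) auto
qed

text \<open>One inequality for two purposes: \<open>\<theta> < 1\<close>, \<open>e = 0\<close> and
  zero payoff give the geometric decay of survival, while \<open>\<theta> = 1\<close> with an error
  \<open>e\<close> gives the approximate submartingale. Once the game has stopped, the payoff no
  longer changes, and the alternative in the hypothesis on \<open>\<theta>\<close> makes
  \<open>F - \<theta> F\<close> vanish.\<close>

lemma integral_payoff_step:
  assumes g: "g \<in> bcontfun" and F: "F \<in> bcontfun"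
    and ge: "\<And>\<omega>. \<omega> \<in> space Omega \<Longrightarrow> \<theta> * g (Q n \<omega>) - e \<le> step_value g F n \<omega>"
    and \<theta>: "\<theta> = 1 \<or> (\<forall>q. F q = 0)" and e: "0 \<le> e"
  shows "\<theta> * (LINT \<omega>|Omega. payoff g F n \<omega>) - e \<le> (LINT \<omega>|Omega. payoff g F (Suc n) \<omega>)"
proof -
  define \<Psi> where "\<Psi> \<omega> = payoff g F (Suc n) \<omega> - \<theta> * payoff g F n \<omega>" for \<omega>
  obtain K where K: "\<And>n \<omega>. \<bar>payoff g F n \<omega>\<bar> \<le> K" using payoff_bounded [OF g F] by blast
  have "- e \<le> (LINT \<omega>|Omega. \<Psi> \<omega>)"
  proof (rule Omega_integral_ge_resampled)
    show "\<Psi> \<in> borel_measurable Omega"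
      unfolding \<Psi>_def using measurable_payoff [OF g F] by simp
    show "\<bar>\<Psi> \<omega>\<bar> \<le> K + \<bar>\<theta>\<bar> * K" for \<omega>
    proof -
      have "\<bar>\<theta> * payoff g F n \<omega>\<bar> \<le> \<bar>\<theta>\<bar> * K"
        unfolding abs_mult using K by (intro mult_left_mono) auto
      then show ?thesis
        using K [of "Suc n" \<omega>] unfolding \<Psi>_def by linarith
    qed
    show "1 \<le> Suc n" by simp
    fix \<omega> assume \<omega>: "\<omega> \<in> space Omega"
    let ?q = "Q n \<omega>"
    let ?S = "game_step p \<epsilon> ?q (\<sigma>I n (hist n \<omega>)) (\<sigma>II n (hist n \<omega>))"
    \<comment> \<open>Survival, position and history up to round \<open>n\<close> do not see the
      resampled outcome, so only the next round is integrated.\<close>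
    have same: "alive n (fun_upd \<omega> (Suc n) x) = alive n \<omega>" "Q n (fun_upd \<omega> (Suc n) x) = ?q"
      "hist n (fun_upd \<omega> (Suc n) x) = hist n \<omega>" for x
      by (auto intro!: alive_cong Q_cong hist_cong)
    show "- e \<le> (LINT x|Omega1. \<Psi> (fun_upd \<omega> (Suc n) x))"
    proof (cases "alive n \<omega>")
      case True
      have "\<Psi> (fun_upd \<omega> (Suc n) x)
          = (if snd (snd x) \<le> d_cut D \<epsilon> ?q then g (?S x) else F ?q) - \<theta> * g ?q" for x
        using stopped_eq [of n "fun_upd \<omega> (Suc n) x"] True
        by (simp add: \<Psi>_def payoff_def alive_Suc same Q_Suc)
      then have "(LINT x|Omega1. \<Psi> (fun_upd \<omega> (Suc n) x))
          = (LINT x|Omega1. (if snd (snd x) \<le> d_cut D \<epsilon> ?q then g (?S x) else F ?q) - \<theta> * g ?q)"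
        by simp
      also have "\<dots> = step_value g F n \<omega> - \<theta> * g ?q"
      proof -
        have [measurable]: "g \<in> borel_measurable borel"
          by (rule bcontfun_borel_measurable [OF g])
        obtain L where L: "0 < L" "\<And>x. \<bar>g x\<bar> \<le> L" using bcontfun_bound [OF g] by blast
        have "(\<lambda>x. if snd (snd x) \<le> d_cut D \<epsilon> ?q then g (?S x) else F ?q) \<in> borel_measurable Omega1"
          unfolding game_step_def by measurable
        moreover have "\<bar>if snd (snd x) \<le> d_cut D \<epsilon> ?q then g (?S x) else F ?q\<bar> \<le> L + \<bar>F ?q\<bar>" for x
          using L(1) L(2) [of "?S x"] by auto
        ultimately have "integrable Omega1 (\<lambda>x. if snd (snd x) \<le> d_cut D \<epsilon> ?q then g (?S x) else F ?q)"
          by (intro Omega1.integrable_const_bound [where B = "L + \<bar>F ?q\<bar>"] AE_I2)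
            (simp_all only: real_norm_def)
        then show ?thesis
          using integral_game_step [OF g d_cut_bounds [OF D \<epsilon>(1)] \<epsilon>(1)]
          by (simp add: Omega1.prob_space step_value_def)
      qed
      finally show ?thesis
        using ge [OF \<omega>] by linarith
    next
      case False
      moreover have "F q - \<theta> * F q = 0" for q
      proof -
        have "\<theta> = 1 \<or> F q = 0" using \<theta> by blast
        then show ?thesis by auto
      qed
      ultimately have "\<Psi> (fun_upd \<omega> (Suc n) x) = 0" for x
        by (simp add: \<Psi>_def payoff_def alive_Suc same)
      then show ?thesis using e by simp
    qed
  qed
  also have "(LINT \<omega>|Omega. \<Psi> \<omega>)
      = (LINT \<omega>|Omega. payoff g F (Suc n) \<omega>) - \<theta> * (LINT \<omega>|Omega. payoff g F n \<omega>)"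
    unfolding \<Psi>_def using integrable_payoff [OF g F] by simp
  finally show ?thesis by linarith
qed

lemma dilated_move_in_hball:
  assumes "is_strategy \<sigma>" "\<omega> \<in> space Omega"
  shows "q \<star> dilation (gamma_p p * \<epsilon>) (\<sigma> n (hist n \<omega>)) \<in> hball q (gamma_p p * \<epsilon>)"
  using move_in_hball [OF assms, of n] gamma_p_pos [OF p] \<epsilon>
  by (intro hmult_dilation_in_hball_iff [THEN iffD2]) auto

text \<open>As \<open>\<phi>\<close> is at least 1, the survival probability is at most the mean of
  \<open>\<phi>\<close> over surviving paths, which shrinks by \<open>\<theta>\<close> in each
  round. The step inequality bounds from below, hence the sign in \<open>g\<close>.\<close>

lemma alive_tendsto_0: "(\<lambda>n. measure Omega {\<omega>\<in>space Omega. alive n \<omega>}) \<longlonglongrightarrow> 0"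
proof -
  obtain \<phi> \<theta> C where bar: "is_barrier D \<epsilon> \<phi> \<theta> C"
    using ex_barrier [OF D \<epsilon>] by blast
  then have \<phi>: "\<phi> \<in> bcontfun" "0 < \<theta>" "\<theta> < 1" "\<And>q. 1 \<le> \<phi> q" "\<And>q. \<phi> q \<le> C"
    "\<And>q. q \<in> D \<Longrightarrow> 1/3 * average3 \<phi> \<epsilon> q + 2/3 * C \<le> \<theta> * \<phi> q"
    by (auto simp: is_barrier_def)
  define g where "g q = - \<phi> q" for q
  have g: "g \<in> bcontfun" and z: "(\<lambda>q. 0 :: real) \<in> (bcontfun :: (heis \<Rightarrow> real) set)"
    unfolding g_def by (intro bcontfun_real_intros \<phi>(1))+
  let ?E = "\<lambda>n. LINT \<omega>|Omega. payoff g (\<lambda>q. 0) n \<omega>"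
  have "\<theta> * g (Q n \<omega>) - 0 \<le> step_value g (\<lambda>q. 0) n \<omega>" for n \<omega>
  proof (cases "Q n \<omega> \<in> D")
    case True
    let ?d = "d_cut D \<epsilon> (Q n \<omega>)"
    have avg: "average3 g \<epsilon> q = - average3 \<phi> \<epsilon> q" for q
      unfolding g_def by (rule average3_uminus [OF \<epsilon>(1) \<phi>(1)])
    define V where "V = (average3 \<phi> \<epsilon> (Q n \<omega> \<star> dilation (gamma_p p * \<epsilon>) (\<sigma>I n (hist n \<omega>)))
        + average3 \<phi> \<epsilon> (Q n \<omega> \<star> dilation (gamma_p p * \<epsilon>) (\<sigma>II n (hist n \<omega>)))
        + average3 \<phi> \<epsilon> (Q n \<omega>)) / 3"
    \<comment> \<open>Nothing is known about the two moves, so both their averages are bounded by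
      \<open>C\<close>; the pure noise term gives the decrease.\<close>
    have "V \<le> \<theta> * \<phi> (Q n \<omega>)"
    proof -
      have "(a + b + c) / 3 \<le> t" if "1/3 * c + 2/3 * C \<le> t" "a \<le> C" "b \<le> C" for a b c t :: real
        using that by (simp add: field_simps)
      then show ?thesis
        unfolding V_def using \<phi>(6) [OF True] average3_le_const [OF \<epsilon>(1) \<phi>(1,5)] by blast
    qed
    moreover have "0 \<le> \<theta> * \<phi> (Q n \<omega>)"
      using \<phi>(2) \<phi>(4) [of "Q n \<omega>"] by simp
    ultimately have "?d * V \<le> 1 * (\<theta> * \<phi> (Q n \<omega>))"
      using d_cut_bounds [OF D \<epsilon>(1), of "Q n \<omega>"]
      by (meson mult_left_mono mult_right_mono order_trans)
    moreover have "step_value g (\<lambda>q. 0) n \<omega> = - (?d * V)"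
      unfolding step_value_def avg V_def by (simp add: field_simps)
    ultimately show ?thesis by (simp add: g_def)
  next
    case False
    then show ?thesis
      using \<phi>(2) \<phi>(4) [of "Q n \<omega>"] \<epsilon>(1) by (simp add: step_value_def d_cut_eq_0 g_def)
  qed
  then have step: "\<theta> * ?E n \<le> ?E (Suc n)" for n
    using integral_payoff_step [OF g z, of \<theta> n 0] by simp
  have E: "- (\<theta> ^ n * \<phi> q0) \<le> ?E n" for n
  proof (induction n)
    case 0
    show ?case by (simp add: payoff_def alive_0 g_def Omega.prob_space)
  next
    case (Suc n)
    have "\<theta> * - (\<theta> ^ n * \<phi> q0) \<le> \<theta> * ?E n"
      using Suc \<phi>(2) by (intro mult_left_mono) auto
    then show ?case using step [of n] by simp
  qed
  have le: "measure Omega {\<omega>\<in>space Omega. alive n \<omega>} \<le> \<theta> ^ n * \<phi> q0" for n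
  proof -
    let ?A = "{\<omega>\<in>space Omega. alive n \<omega>}"
    have A: "?A \<in> sets Omega" by measurable
    have "measure Omega ?A = (LINT \<omega>|Omega. indicator ?A \<omega>)"
      using A by (simp add: Int_absorb2 sets.sets_into_space)
    also have "\<dots> \<le> (LINT \<omega>|Omega. - payoff g (\<lambda>q. 0) n \<omega>)"
    proof (rule integral_mono)
      show "integrable Omega (indicat_real ?A)"
        using A by (simp add: Omega.emeasure_eq_measure)
      show "indicator ?A \<omega> \<le> - payoff g (\<lambda>q. 0) n \<omega>" for \<omega>
        using \<phi>(4) [of "Q n \<omega>"] by (simp add: payoff_def g_def indicator_def)
    qed (use integrable_payoff [OF g z] in simp)
    finally show ?thesis using E [of n] by simp
  qed
  show ?thesis
  proof (rule tendsto_sandwich)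
    show "\<forall>\<^sub>F n in sequentially. 0 \<le> measure Omega {\<omega>\<in>space Omega. alive n \<omega>}"
      by (rule always_eventually, rule allI, rule measure_nonneg)
    show "\<forall>\<^sub>F n in sequentially. measure Omega {\<omega>\<in>space Omega. alive n \<omega>} \<le> \<theta> ^ n * \<phi> q0"
      by (rule always_eventually, rule allI, rule le)
    show "(\<lambda>n. 0 :: real) \<longlonglongrightarrow> 0"
      by (rule tendsto_const)
    show "(\<lambda>n. \<theta> ^ n * \<phi> q0) \<longlonglongrightarrow> 0"
      using \<phi>(2,3) by (intro tendsto_mult_left_zero LIMSEQ_realpow_zero) auto
  qed
qed

text \<open>After stopping, the payoff is already \<open>F (stopped \<omega>)\<close>. The
  integrands differ only on surviving paths, by at most \<open>K + L\<close>, so the interim value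
  \<open>g\<close> disappears in the limit.\<close>

lemma payoff_tendsto:
  assumes g: "g \<in> bcontfun" and F: "F \<in> bcontfun"
  shows "(\<lambda>n. LINT \<omega>|Omega. payoff g F n \<omega>) \<longlonglongrightarrow> (LINT \<omega>|Omega. F (stopped \<omega>))"
proof -
  obtain K where K: "0 < K" "\<And>x. \<bar>g x\<bar> \<le> K" using bcontfun_bound [OF g] by blast
  obtain L where L: "0 < L" "\<And>x. \<bar>F x\<bar> \<le> L" using bcontfun_bound [OF F] by blast
  note [measurable] = bcontfun_borel_measurable [OF F] measurable_stopped
  have intF: "integrable Omega (\<lambda>\<omega>. F (stopped \<omega>))"
    using L by (intro Omega.integrable_const_bound [where B = L]) auto
  let ?P = "\<lambda>n. measure Omega {\<omega>\<in>space Omega. alive n \<omega>}"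
  have bd: "\<bar>(LINT \<omega>|Omega. payoff g F n \<omega>) - (LINT \<omega>|Omega. F (stopped \<omega>))\<bar> \<le> (K + L) * ?P n" for n
  proof -
    let ?A = "{\<omega>\<in>space Omega. alive n \<omega>}"
    have A: "?A \<in> sets Omega" by measurable
    have "(LINT \<omega>|Omega. payoff g F n \<omega>) - (LINT \<omega>|Omega. F (stopped \<omega>))
        = (LINT \<omega>|Omega. payoff g F n \<omega> - F (stopped \<omega>))"
      by (rule Bochner_Integration.integral_diff [OF integrable_payoff [OF g F] intF, symmetric])
    also have "\<bar>\<dots>\<bar> \<le> (LINT \<omega>|Omega. \<bar>payoff g F n \<omega> - F (stopped \<omega>)\<bar>)"
      by (rule integral_abs_bound)
    also have "\<dots> \<le> (LINT \<omega>|Omega. (K + L) * indicator ?A \<omega>)"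
    proof (rule integral_mono)
      show "integrable Omega (\<lambda>\<omega>. \<bar>payoff g F n \<omega> - F (stopped \<omega>)\<bar>)"
        by (intro integrable_abs Bochner_Integration.integrable_diff integrable_payoff [OF g F] intF)
      show "integrable Omega (\<lambda>\<omega>. (K + L) * indicat_real ?A \<omega>)"
        using A by (intro integrable_mult_right) (simp add: Omega.emeasure_eq_measure)
      show "\<bar>payoff g F n \<omega> - F (stopped \<omega>)\<bar> \<le> (K + L) * indicator ?A \<omega>"
        if "\<omega> \<in> space Omega" for \<omega>
        using that K(2) [of "Q n \<omega>"] L(2) [of "stopped \<omega>"]
          abs_triangle_ineq4 [of "g (Q n \<omega>)" "F (stopped \<omega>)"]
        by (cases "alive n \<omega>") (simp_all add: payoff_def)
    qed
    also have "\<dots> = (K + L) * ?P n"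
      using A by (simp add: Int_absorb2 sets.sets_into_space)
    finally show ?thesis .
  qed
  have "(\<lambda>n. (LINT \<omega>|Omega. payoff g F n \<omega>) - (LINT \<omega>|Omega. F (stopped \<omega>))) \<longlonglongrightarrow> 0"
  proof (rule Lim_null_comparison)
    show "(\<lambda>n. (K + L) * ?P n) \<longlonglongrightarrow> 0"
      by (rule tendsto_mult_right_zero [OF alive_tendsto_0])
    show "\<forall>\<^sub>F n in sequentially. norm ((LINT \<omega>|Omega. payoff g F n \<omega>)
        - (LINT \<omega>|Omega. F (stopped \<omega>))) \<le> (K + L) * ?P n"
      unfolding real_norm_def by (rule always_eventually, rule allI, rule bd)
  qed
  then show ?thesis by (rule LIM_zero_cancel)
qed

text \<open>Any move of player I gives at least the infimum and the move of player II nearly the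
  supremum. So the mean after one more round is at least the right-hand side of the equation for
  \<open>u\<close> up to the error.\<close>

lemma solution_le_expectation:
  assumes u: "bdd_cont_solution p D F \<epsilon> u" and F: "F \<in> bcontfun" and e: "0 < e"
    and opt: "\<And>n \<omega>. (SUP q\<in>hball (Q n \<omega>) (gamma_p p * \<epsilon>). average3 u \<epsilon> q) - e / 2 ^ Suc n
        \<le> average3 u \<epsilon> (Q n \<omega> \<star> dilation (gamma_p p * \<epsilon>) (\<sigma>II n (hist n \<omega>)))"
  shows "u q0 - e \<le> (LINT \<omega>|Omega. F (stopped \<omega>))"
proof -
  have ub: "u \<in> bcontfun" and u_eq: "\<And>q. u q = mv_fixpoint_map p D F \<epsilon> u q"
    using u unfolding bdd_cont_solution_iff by metis+
  let ?E = "\<lambda>n. LINT \<omega>|Omega. payoff u F n \<omega>"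
  have step: "?E n - e / 2 ^ Suc n \<le> ?E (Suc n)" for n
  proof -
    have "1 * ?E n - e / 2 ^ Suc n \<le> ?E (Suc n)"
    proof (rule integral_payoff_step [OF ub F])
      show "0 \<le> e / 2 ^ Suc n" using e by simp
      fix \<omega> assume \<omega>: "\<omega> \<in> space Omega"
      let ?q = "Q n \<omega>" and ?r = "gamma_p p * \<epsilon>"
      let ?d = "d_cut D \<epsilon> ?q"
      let ?I = "INF q\<in>hball ?q ?r. average3 u \<epsilon> q" and ?S = "SUP q\<in>hball ?q ?r. average3 u \<epsilon> q"
      define V where "V = (average3 u \<epsilon> (?q \<star> dilation ?r (\<sigma>I n (hist n \<omega>)))
        + average3 u \<epsilon> (?q \<star> dilation ?r (\<sigma>II n (hist n \<omega>))) + average3 u \<epsilon> ?q) / 3"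
      have "?I \<le> average3 u \<epsilon> (?q \<star> dilation ?r (\<sigma>I n (hist n \<omega>)))"
        by (rule cINF_lower [OF bdd_image_bcontfun(2) [OF average3_bcontfun [OF \<epsilon>(1) ub]]
              dilated_move_in_hball [OF \<sigma>I \<omega>]])
      moreover have "0 \<le> e / 2 ^ Suc n" using e by simp
      moreover have "1/3 * c + 1/3 * i + 1/3 * s - t \<le> (a + b + c) / 3"
        if "i \<le> a" "0 \<le> t" "s - t \<le> b" for a b c i s t :: real
        using that by (simp add: field_simps)
      ultimately have "mv_operator p \<epsilon> u ?q - e / 2 ^ Suc n \<le> V"
        using opt [of n \<omega>] unfolding mv_operator_def V_def by blast
      then have "?d * (mv_operator p \<epsilon> u ?q - e / 2 ^ Suc n) \<le> ?d * V"
        using d_cut_bounds [OF D \<epsilon>(1)] by (intro mult_left_mono) auto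
      moreover have "?d * (e / 2 ^ Suc n) \<le> 1 * (e / 2 ^ Suc n)"
        using d_cut_bounds [OF D \<epsilon>(1)] e by (intro mult_right_mono) auto
      moreover have "u ?q = ?d * mv_operator p \<epsilon> u ?q + (1 - ?d) * F ?q"
        unfolding mv_fixpoint_map_def [symmetric] by (rule u_eq)
      moreover have "step_value u F n \<omega> = ?d * V + (1 - ?d) * F ?q"
        by (simp only: step_value_def V_def)
      ultimately show "1 * u ?q - e / 2 ^ Suc n \<le> step_value u F n \<omega>"
        by (simp only: right_diff_distrib mult_1)
    qed simp
    then show ?thesis by simp
  qed
  \<comment> \<open>The first \<open>n\<close> errors \<open>e / 2 ^ Suc k\<close> add up to
    \<open>e * (1 - 1 / 2 ^ n)\<close>.\<close>
  have "u q0 - e * (1 - 1 / 2 ^ n) \<le> ?E n" for n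
  proof (induction n)
    case 0
    show ?case by (simp add: payoff_def alive_0 Omega.prob_space)
  next
    case (Suc n)
    then show ?case using step [of n] by (simp add: field_simps)
  qed
  moreover have "e * (1 - 1 / 2 ^ n) \<le> e" for n :: nat
    using e by (simp add: field_simps)
  ultimately have "u q0 - e \<le> ?E n" for n
    by (meson diff_left_mono order_trans)
  then show ?thesis
    by (intro LIMSEQ_le_const [OF payoff_tendsto [OF ub F]]) auto
qed

end

section \<open>Boundary and interior estimates\<close>

text \<open>Over the open ball the supremum need not be attained, and the choice must be measurable
  in \<open>q\<close>. Taking the first sufficiently good element in an enumeration of a countable
  dense set of moves settles both.\<close>

lemma near_optimal_selection:
  fixes f :: "heis \<Rightarrow> real"
  assumes f: "f \<in> bcontfun" and r: "0 < r" and e: "0 < e"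
  shows "\<exists>s. s \<in> borel \<rightarrow>\<^sub>M restrict_space borel (hball 0 1) \<and>
    (\<forall>q. (SUP q'\<in>hball q r. f q') - e \<le> f (q \<star> dilation r (s q)))"
proof -
  let ?S = "\<lambda>q. SUP q'\<in>hball q r. f q'"
  obtain B :: "heis set" where B: "countable B" "\<And>X. open X \<Longrightarrow> X \<noteq> {} \<Longrightarrow> \<exists>d\<in>B. d \<in> X"
    using countable_dense_exists [where 'a = heis] by blast
  define A where "A = B \<inter> hball 0 1"
  have fc: "continuous_on UNIV f" using f by (simp add: bcontfun_iff)
  have Sc: "continuous_on UNIV ?S"
    using SUP_hball_bcontfun [OF f r] by (simp add: bcontfun_iff)
  have move: "continuous_on UNIV (\<lambda>w. f (q \<star> dilation r w))" for q
    by (rule continuous_on_compose2 [OF fc]) (auto intro!: continuous_intros)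
  have start: "continuous_on UNIV (\<lambda>q. f (q \<star> dilation r w))" for w
    by (rule continuous_on_compose2 [OF fc]) (auto intro!: continuous_intros)
  have ex: "\<exists>b\<in>A. ?S q - e < f (q \<star> dilation r b)" for q
  proof -
    have "?S q - e < ?S q" using e by simp
    then obtain q' where q': "q' \<in> hball q r" "?S q - e < f q'"
      using less_cSUP_iff [OF hball_nonempty [OF r] bdd_image_bcontfun(1) [OF f]] by blast
    then obtain w where w: "w \<in> hball 0 1" "q' = q \<star> dilation r w"
      unfolding hball_eq_image [OF r] by blast
    \<comment> \<open>The inequality is strict, so the good moves form an open set, which meets the
      dense set.\<close>
    let ?U = "hball 0 1 \<inter> {w. ?S q - e < f (q \<star> dilation r w)}"
    have "open ?U"
      by (intro open_Int open_hball open_Collect_less continuous_on_const move)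
    moreover have "w \<in> ?U" using w q' by simp
    ultimately obtain b where "b \<in> B" "b \<in> ?U" using B(2) by blast
    then show ?thesis unfolding A_def by blast
  qed
  then have A0: "A \<noteq> {}" by blast
  have Ac: "countable A" using B(1) by (simp add: A_def)
  define a where "a = from_nat_into A"
  have aA: "a k \<in> A" for k
    unfolding a_def by (rule from_nat_into [OF A0])
  have "\<exists>k. ?S q - e < f (q \<star> dilation r (a k))" for q
  proof -
    obtain b where "b \<in> A" "?S q - e < f (q \<star> dilation r b)" using ex by blast
    moreover obtain k where "a k = b"
      using from_nat_into_surj [OF Ac \<open>b \<in> A\<close>] unfolding a_def by blast
    ultimately show ?thesis by blast
  qed
  then have best: "?S q - e < f (q \<star> dilation r (a (LEAST k. ?S q - e < f (q \<star> dilation r (a k)))))" for q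
    by (rule LeastI_ex)
  define s where "s q = a (LEAST k. ?S q - e < f (q \<star> dilation r (a k)))" for q
  have "(\<lambda>q. LEAST k. ?S q - e < f (q \<star> dilation r (a k))) \<in> borel \<rightarrow>\<^sub>M count_space UNIV"
  proof (rule measurable_Least)
    fix k
    have "(\<lambda>q. ?S q - e) \<in> borel_measurable borel"
      by (intro borel_measurable_continuous_onI continuous_on_diff Sc continuous_on_const)
    moreover have "(\<lambda>q. f (q \<star> dilation r (a k))) \<in> borel_measurable borel"
      by (intro borel_measurable_continuous_onI start)
    ultimately show "Measurable.pred borel (\<lambda>q. ?S q - e < f (q \<star> dilation r (a k)))"
      by (rule borel_measurable_pred_less)
  qed
  then have "s \<in> borel \<rightarrow>\<^sub>M restrict_space borel (hball 0 1)"
    unfolding s_def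
  proof (rule measurable_compose_countable [rotated])
    fix k
    have "a k \<in> hball 0 1" using aA [of k] by (simp add: A_def)
    then show "(\<lambda>q. a k) \<in> borel \<rightarrow>\<^sub>M restrict_space borel (hball 0 1)"
      by (intro measurable_const) (simp add: space_restrict_space)
  qed
  moreover have "?S q - e \<le> f (q \<star> dilation r (s q))" for q
    unfolding s_def using best by (rule less_imp_le)
  ultimately show ?thesis by blast
qed

text \<open>A history keeps its starting point apart from the family indexed from 1, hence the
  separate case \<open>n = 0\<close>.\<close>

definition last_position :: "nat \<Rightarrow> history \<Rightarrow> heis" where
  "last_position n h = (if n = 0 then fst h else fst (snd h n))"

lemma measurable_last_position: "last_position n \<in> histories n \<rightarrow>\<^sub>M borel"
proof (cases "n = 0")
  case True
  then show ?thesis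
    unfolding last_position_def histories_def by (simp add: measurable_fst)
next
  case False
  then have "(\<lambda>h. h n) \<in> (\<Pi>\<^sub>M i\<in>{1..n}. borel \<Otimes>\<^sub>M Omega1) \<rightarrow>\<^sub>M (borel \<Otimes>\<^sub>M Omega1 :: (heis \<times> outcome1) measure)"
    by (intro measurable_component_singleton) auto
  from measurable_compose [OF measurable_compose [OF measurable_snd this] measurable_fst] False
  show ?thesis
    unfolding last_position_def histories_def by simp
qed

lemma ex_near_optimal_strategy:
  fixes f :: "heis \<Rightarrow> real"
  assumes f: "f \<in> bcontfun" and r: "0 < r" and e: "\<And>n. 0 < e n"
  shows "\<exists>\<sigma>. is_strategy \<sigma> \<and> (\<forall>n h. (SUP q\<in>hball (last_position n h) r. f q) - e n
    \<le> f (last_position n h \<star> dilation r (\<sigma> n h)))"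
proof -
  have "\<forall>n. \<exists>s. s \<in> borel \<rightarrow>\<^sub>M restrict_space borel (hball 0 1) \<and>
    (\<forall>q. (SUP q'\<in>hball q r. f q') - e n \<le> f (q \<star> dilation r (s q)))"
    using near_optimal_selection [OF f r e] by (rule allI)
  from choice [OF this] obtain s where
    s: "\<And>n. s n \<in> borel \<rightarrow>\<^sub>M restrict_space borel (hball 0 1)"
    "\<And>n q. (SUP q'\<in>hball q r. f q') - e n \<le> f (q \<star> dilation r (s n q))"
    by blast
  have "is_strategy (\<lambda>n h. s n (last_position n h))"
    unfolding is_strategy_def using measurable_compose [OF measurable_last_position s(1)] by (rule allI)
  then show ?thesis using s(2) by blast
qed

lemma ex_response_strategy:
  assumes p: "2 < p" and \<epsilon>: "0 < \<epsilon>" "\<epsilon> < 1" and D: "bounded D"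
    and u: "bdd_cont_solution p D F \<epsilon> u" and F: "F \<in> bcontfun" and e: "0 < e"
    and \<sigma>I: "is_strategy \<sigma>I"
  shows "\<exists>\<sigma>II. is_strategy \<sigma>II \<and>
    u q0 - e \<le> (LINT \<omega>|Omega. F (stopped_position p D \<epsilon> q0 \<sigma>I \<sigma>II \<omega>))"
proof -
  have ub: "u \<in> bcontfun" using u by (simp add: bdd_cont_solution_iff)
  have r: "0 < gamma_p p * \<epsilon>" using gamma_p_pos [OF p] \<epsilon> by simp
  have "0 < e / 2 ^ Suc n" for n using e by simp
  from ex_near_optimal_strategy [OF average3_bcontfun [OF \<epsilon>(1) ub] r, of "\<lambda>n. e / 2 ^ Suc n", OF this]
  obtain \<sigma>II where \<sigma>II: "is_strategy \<sigma>II"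
    and opt: "\<And>n h. (SUP q\<in>hball (last_position n h) (gamma_p p * \<epsilon>). average3 u \<epsilon> q) - e / 2 ^ Suc n
      \<le> average3 u \<epsilon> (last_position n h \<star> dilation (gamma_p p * \<epsilon>) (\<sigma>II n h))"
    by blast
  interpret tug_of_war p \<epsilon> D q0 \<sigma>I \<sigma>II
    using p \<epsilon> D \<sigma>I \<sigma>II by unfold_locales
  have last: "last_position n (hist n \<omega>) = Q n \<omega>" for n \<omega>
    by (simp add: last_position_def hist_def)
  have "u q0 - e \<le> (LINT \<omega>|Omega. F (stopped \<omega>))"
  proof (rule solution_le_expectation [OF u F e])
    show "(SUP q\<in>hball (Q n \<omega>) (gamma_p p * \<epsilon>). average3 u \<epsilon> q) - e / 2 ^ Suc n
        \<le> average3 u \<epsilon> (Q n \<omega> \<star> dilation (gamma_p p * \<epsilon>) (\<sigma>II n (hist n \<omega>)))" for n \<omega>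
      using opt [of n "hist n \<omega>"] unfolding last .
  qed
  then show ?thesis using \<sigma>II by blast
qed

text \<open>Three errors of \<open>\<eta> / 3\<close>: the near-optimal reply of player II, the
  continuity of \<open>F\<close> at \<open>q0\<close>, and the paths that stop away from
  \<open>q0\<close>. All solutions \<open>u\<close> are covered, so that the bound can also be
  applied to \<open>- u\<close>.\<close>

lemma game_regular_point_upper:
  assumes p: "2 < p" and D: "bounded D" and reg: "game_regular_point p D q0"
    and F: "F \<in> bcontfun" and \<eta>: "0 < \<eta>"
  shows "\<exists>\<delta>>0. \<exists>\<epsilon>'\<in>{0<..<1}. \<forall>\<epsilon>\<in>{0<..<\<epsilon>'}. \<forall>p0\<in>hball q0 \<delta>. \<forall>u.
    bdd_cont_solution p D F \<epsilon> u \<longrightarrow> u p0 \<le> F q0 + \<eta>"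
proof -
  obtain M where M: "0 < M" "\<And>x. \<bar>F x\<bar> \<le> M" using bcontfun_bound [OF F] by blast
  have "0 < \<eta> / 3" using \<eta> by simp
  then have "\<exists>d>0. \<forall>x. dist x q0 < d \<longrightarrow> dist (F x) (F q0) < \<eta> / 3"
    using F unfolding bcontfun_iff continuous_on_iff by blast
  then obtain d where d: "0 < d" "\<And>x. dist x q0 < d \<Longrightarrow> dist (F x) (F q0) < \<eta> / 3" by blast
  obtain \<delta> where \<delta>: "0 < \<delta>" "hball q0 \<delta> \<subseteq> ball q0 d"
    using hball_subset_ball [of "{q0}" d] d(1) by auto
  have F\<delta>: "F x \<le> F q0 + \<eta> / 3" if "x \<in> hball q0 \<delta>" for x
  proof -
    have "dist x q0 < d" using that \<delta>(2) by (auto simp: dist_commute)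
    then have "\<bar>F x - F q0\<bar> < \<eta> / 3" using d(2) by (simp add: dist_real_def)
    then show ?thesis using abs_ge_self [of "F x - F q0"] by linarith
  qed
  \<comment> \<open>On a bad path the payoff exceeds \<open>F q0\<close> by at most
    \<open>2 * M\<close>, so bad paths of probability at most \<open>\<eta>'\<close> cost at most
    \<open>\<eta> / 3\<close>.\<close>
  define \<eta>' where "\<eta>' = \<eta> / (6 * M)"
  have \<eta>': "0 < \<eta>'" "2 * M * \<eta>' = \<eta> / 3" using \<eta> M by (simp_all add: \<eta>'_def)
  obtain \<delta>' \<epsilon>' where \<delta>': "\<delta>' \<in> {0<..<\<delta>}" and \<epsilon>': "\<epsilon>' \<in> {0<..<1}"
    and win: "\<And>\<epsilon> p0. \<epsilon> \<in> {0<..<\<epsilon>'} \<Longrightarrow> p0 \<in> hball q0 \<delta>' \<Longrightarrow> \<exists>\<sigma>I. is_strategy \<sigma>I \<and>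
      (\<forall>\<sigma>II. is_strategy \<sigma>II \<longrightarrow>
       measure Omega {\<omega> \<in> space Omega. stopped_position p D \<epsilon> p0 \<sigma>I \<sigma>II \<omega> \<in> hball q0 \<delta>} \<ge> 1 - \<eta>')"
    using reg [unfolded game_regular_point_def, rule_format, OF \<eta>'(1) \<delta>(1)] by blast
  have "u p0 \<le> F q0 + \<eta>"
    if \<epsilon>: "\<epsilon> \<in> {0<..<\<epsilon>'}" and p0: "p0 \<in> hball q0 \<delta>'" and u: "bdd_cont_solution p D F \<epsilon> u"
    for \<epsilon> p0 u
  proof -
    have \<epsilon>1: "0 < \<epsilon>" "\<epsilon> < 1" using \<epsilon> \<epsilon>' by auto
    obtain \<sigma>I where \<sigma>I: "is_strategy \<sigma>I" and winI: "\<And>\<sigma>II. is_strategy \<sigma>II \<Longrightarrow>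
       measure Omega {\<omega> \<in> space Omega. stopped_position p D \<epsilon> p0 \<sigma>I \<sigma>II \<omega> \<in> hball q0 \<delta>} \<ge> 1 - \<eta>'"
      using win [OF \<epsilon> p0] by blast
    have "0 < \<eta> / 3" using \<eta> by simp
    from ex_response_strategy [OF p \<epsilon>1 D u F this \<sigma>I, of p0]
    obtain \<sigma>II where \<sigma>II: "is_strategy \<sigma>II"
      and le: "u p0 - \<eta> / 3 \<le> (LINT \<omega>|Omega. F (stopped_position p D \<epsilon> p0 \<sigma>I \<sigma>II \<omega>))"
      by blast
    interpret tug_of_war p \<epsilon> D p0 \<sigma>I \<sigma>II
      using p \<epsilon>1 D \<sigma>I \<sigma>II by unfold_locales
    let ?A = "{\<omega> \<in> space Omega. stopped \<omega> \<in> hball q0 \<delta>}"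
    note [measurable] = measurable_stopped bcontfun_borel_measurable [OF F]
    have A: "?A \<in> sets Omega" by measurable
    have "(LINT \<omega>|Omega. F (stopped \<omega>))
        \<le> (LINT \<omega>|Omega. (F q0 + \<eta> / 3 + 2 * M) - 2 * M * indicator ?A \<omega>)"
    proof (rule integral_mono)
      show "integrable Omega (\<lambda>\<omega>. F (stopped \<omega>))"
        by (rule Omega.integrable_const_bound [where B = M]) (simp_all add: M(2))
      show "integrable Omega (\<lambda>\<omega>. (F q0 + \<eta> / 3 + 2 * M) - 2 * M * indicat_real ?A \<omega>)"
        using A by (intro Bochner_Integration.integrable_diff integrable_mult_right)
          (simp_all add: Omega.emeasure_eq_measure)
      fix \<omega> assume \<omega>: "\<omega> \<in> space Omega"
      show "F (stopped \<omega>) \<le> (F q0 + \<eta> / 3 + 2 * M) - 2 * M * indicator ?A \<omega>"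
      proof (cases "stopped \<omega> \<in> hball q0 \<delta>")
        case True
        then show ?thesis using F\<delta> [OF True] \<omega> by simp
      next
        case False
        then show ?thesis using M(2) [of "stopped \<omega>"] M(2) [of q0] \<eta> by simp
      qed
    qed
    also have "\<dots> = (F q0 + \<eta> / 3 + 2 * M) - 2 * M * measure Omega ?A"
      using A by (subst Bochner_Integration.integral_diff)
        (simp_all add: Omega.emeasure_eq_measure Omega.prob_space Int_absorb2 sets.sets_into_space)
    also have "\<dots> \<le> (F q0 + \<eta> / 3 + 2 * M) - 2 * M * (1 - \<eta>')"
      using winI [OF \<sigma>II] M(1) by (intro diff_left_mono mult_left_mono) auto
    also have "\<dots> = F q0 + \<eta> / 3 + \<eta> / 3"
      using \<eta>'(2) by (simp add: right_diff_distrib)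
    finally show ?thesis using le by simp
  qed
  moreover have "0 < \<delta>'" using \<delta>' by simp
  ultimately show ?thesis using \<epsilon>' by blast
qed

text \<open>Game-regularity does not mention \<open>F\<close>, so the upper bound holds for
  \<open>- F\<close> as well, and the negated solution turns it into the lower bound.\<close>

lemma game_regular_point_boundary:
  assumes p: "2 < p" and D: "bounded D" and reg: "game_regular_point p D q0"
    and F: "F \<in> bcontfun" and \<eta>: "0 < \<eta>"
  shows "\<exists>\<delta>>0. \<exists>\<epsilon>'\<in>{0<..<1}. \<forall>\<epsilon>\<in>{0<..<\<epsilon>'}. \<forall>x\<in>hball q0 \<delta>. \<bar>u_eps p D F \<epsilon> x - F q0\<bar> \<le> \<eta>"
proof -
  obtain \<delta>1 \<epsilon>1 where 1: "0 < \<delta>1" "\<epsilon>1 \<in> {0<..<1}"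
    "\<And>\<epsilon> x u. \<epsilon> \<in> {0<..<\<epsilon>1} \<Longrightarrow> x \<in> hball q0 \<delta>1 \<Longrightarrow> bdd_cont_solution p D F \<epsilon> u \<Longrightarrow> u x \<le> F q0 + \<eta>"
    using game_regular_point_upper [OF p D reg F \<eta>] by blast
  obtain \<delta>2 \<epsilon>2 where 2: "0 < \<delta>2" "\<epsilon>2 \<in> {0<..<1}"
    "\<And>\<epsilon> x u. \<epsilon> \<in> {0<..<\<epsilon>2} \<Longrightarrow> x \<in> hball q0 \<delta>2 \<Longrightarrow>
      bdd_cont_solution p D (\<lambda>q. - F q) \<epsilon> u \<Longrightarrow> u x \<le> - F q0 + \<eta>"
    using game_regular_point_upper [OF p D reg bcontfun_real_intros(5) [OF F] \<eta>] by blast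
  have "\<bar>u_eps p D F \<epsilon> x - F q0\<bar> \<le> \<eta>"
    if \<epsilon>: "\<epsilon> \<in> {0<..<min \<epsilon>1 \<epsilon>2}" and x: "x \<in> hball q0 (min \<delta>1 \<delta>2)" for \<epsilon> x
  proof -
    have \<epsilon>': "0 < \<epsilon>" "\<epsilon> < 1" "\<epsilon> \<in> {0<..<\<epsilon>1}" "\<epsilon> \<in> {0<..<\<epsilon>2}" using \<epsilon> 1(2) by auto
    have x': "x \<in> hball q0 \<delta>1" "x \<in> hball q0 \<delta>2" using x by (auto simp: hball_def)
    note sol = u_eps_solution [OF p D F \<epsilon>'(1,2)]
    show ?thesis
      using 1(3) [OF \<epsilon>'(3) x'(1) sol]
        2(3) [OF \<epsilon>'(4) x'(2) bdd_cont_solution_uminus [OF \<epsilon>'(1) sol]] by linarith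
  qed
  moreover have "0 < min \<delta>1 \<delta>2" "min \<epsilon>1 \<epsilon>2 \<in> {0<..<1}" using 1 2 by auto
  ultimately show ?thesis by blast
qed

text \<open>A finite subcover of the boundary gives a common \<open>\<epsilon>'\<close>. A Lebesgue
  number \<open>e\<close> of it puts any two points near the same boundary point into a single ball
  of the cover, where both values are close to the same \<open>F q\<close>.\<close>

lemma game_regular_boundary_oscillation:
  assumes p: "2 < p" and D: "bounded D" and reg: "game_regular p D"
    and F: "F \<in> bcontfun" and \<eta>: "0 < \<eta>"
  shows "\<exists>e>0. \<exists>\<epsilon>'\<in>{0<..<1}. \<forall>\<epsilon>\<in>{0<..<\<epsilon>'}. \<forall>q0\<in>frontier D. \<forall>x\<in>ball q0 e. \<forall>y\<in>ball q0 e.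
    \<bar>u_eps p D F \<epsilon> x - u_eps p D F \<epsilon> y\<bar> \<le> \<eta>"
proof -
  have "0 < \<eta> / 2" using \<eta> by simp
  then have "\<forall>q\<in>frontier D. \<exists>\<delta>. 0 < \<delta> \<and> (\<exists>\<epsilon>'\<in>{0<..<1}. \<forall>\<epsilon>\<in>{0<..<\<epsilon>'}. \<forall>x\<in>hball q \<delta>.
      \<bar>u_eps p D F \<epsilon> x - F q\<bar> \<le> \<eta> / 2)"
    using game_regular_point_boundary [OF p D _ F] reg unfolding game_regular_def by blast
  from bchoice [OF this] obtain \<delta> where \<delta>: "\<And>q. q \<in> frontier D \<Longrightarrow> 0 < \<delta> q"
    "\<forall>q\<in>frontier D. \<exists>\<epsilon>'. \<epsilon>' \<in> {0<..<1} \<and> (\<forall>\<epsilon>\<in>{0<..<\<epsilon>'}. \<forall>x\<in>hball q (\<delta> q). \<bar>u_eps p D F \<epsilon> x - F q\<bar> \<le> \<eta> / 2)"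
    by blast
  from bchoice [OF \<delta>(2)] obtain E where E: "\<And>q. q \<in> frontier D \<Longrightarrow> E q \<in> {0<..<1 :: real}"
    "\<And>q \<epsilon> x. q \<in> frontier D \<Longrightarrow> \<epsilon> \<in> {0<..<E q} \<Longrightarrow> x \<in> hball q (\<delta> q) \<Longrightarrow> \<bar>u_eps p D F \<epsilon> x - F q\<bar> \<le> \<eta> / 2"
    by blast
  have comp: "compact (frontier D)"
    using D by (rule compact_frontier_bounded)
  have "frontier D \<subseteq> (\<Union>q\<in>frontier D. hball q (\<delta> q))"
    using \<delta>(1) center_in_hball by blast
  from compactE_image [OF comp open_hball this] obtain C where
    C: "C \<subseteq> frontier D" "finite C" "frontier D \<subseteq> (\<Union>q\<in>C. hball q (\<delta> q))" by blast
  obtain e where e: "0 < e" "\<And>x. x \<in> frontier D \<Longrightarrow> \<exists>G\<in>(\<lambda>q. hball q (\<delta> q)) ` C. ball x e \<subseteq> G"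
    using Heine_Borel_lemma [OF comp C(3)] open_hball by blast
  \<comment> \<open>The extra element \<open>1/2\<close> keeps the set nonempty even if
    \<open>C\<close> is empty.\<close>
  define \<epsilon>' where "\<epsilon>' = Min (insert (1/2) (E ` C))"
  have \<epsilon>': "\<epsilon>' \<in> {0<..<1}" "\<And>q. q \<in> C \<Longrightarrow> \<epsilon>' \<le> E q"
  proof -
    have fin: "finite (insert (1/2) (E ` C))" using C(2) by simp
    have "\<epsilon>' \<in> insert (1/2) (E ` C)"
      unfolding \<epsilon>'_def using fin by (rule Min_in) simp
    then show "\<epsilon>' \<in> {0<..<1}" using E(1) C(1) by auto
    show "\<epsilon>' \<le> E q" if "q \<in> C" for q
      unfolding \<epsilon>'_def using fin that by (intro Min_le) auto
  qed
  have "\<bar>u_eps p D F \<epsilon> x - u_eps p D F \<epsilon> y\<bar> \<le> \<eta>"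
    if \<epsilon>: "\<epsilon> \<in> {0<..<\<epsilon>'}" and q0: "q0 \<in> frontier D" and xy: "x \<in> ball q0 e" "y \<in> ball q0 e" for \<epsilon> q0 x y
  proof -
    obtain q where q: "q \<in> C" "ball q0 e \<subseteq> hball q (\<delta> q)" using e(2) [OF q0] by blast
    have "q \<in> frontier D" using q(1) C(1) by blast
    moreover have "\<epsilon> \<in> {0<..<E q}" using \<epsilon> \<epsilon>'(2) [OF q(1)] by simp
    ultimately have "\<bar>u_eps p D F \<epsilon> x - F q\<bar> \<le> \<eta> / 2" "\<bar>u_eps p D F \<epsilon> y - F q\<bar> \<le> \<eta> / 2"
      using E(2) q(2) xy by blast+
    then show ?thesis by linarith
  qed
  then show ?thesis using e(1) \<epsilon>'(1) by blast
qed

section \<open>Left translations and the interior estimate\<close>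

lemma left_translation_uniform:
  fixes D :: "heis set"
  assumes D: "bounded D" and \<kappa>: "0 < \<kappa>"
  shows "\<exists>\<delta>>0. \<forall>q\<in>D. \<forall>q'\<in>D. \<forall>x\<in>D. dist q q' < \<delta> \<longrightarrow> dist x (q' \<star> hinv q \<star> x) < \<kappa>"
proof -
  let ?K = "closure D"
  \<comment> \<open>\<open>h (q', q, x)\<close> is the translate of \<open>x\<close> by the element
    carrying \<open>q\<close> to \<open>q'\<close>, and equals \<open>x\<close> when
    \<open>q' = q\<close>. Uniform continuity in all three variables makes the displacement small
    uniformly in \<open>x\<close>.\<close>
  define h where "h y = fst y \<star> hinv (fst (snd y)) \<star> snd (snd y)" for y :: "heis \<times> heis \<times> heis"
  have "compact (?K \<times> ?K \<times> ?K)"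
    using D by (intro compact_Times) (simp_all add: compact_closure)
  moreover have "continuous_on (?K \<times> ?K \<times> ?K) h"
    unfolding h_def by (intro continuous_intros)
  ultimately have "uniformly_continuous_on (?K \<times> ?K \<times> ?K) h"
    by (rule compact_uniformly_continuous [rotated])
  then obtain \<delta> where \<delta>: "0 < \<delta>" "\<forall>x\<in>?K \<times> ?K \<times> ?K. \<forall>y\<in>?K \<times> ?K \<times> ?K. dist y x < \<delta> \<longrightarrow> dist (h y) (h x) < \<kappa>"
    unfolding uniformly_continuous_on_def using \<kappa> by blast
  have "dist x (q' \<star> hinv q \<star> x) < \<kappa>" if "q \<in> D" "q' \<in> D" "x \<in> D" "dist q q' < \<delta>" for q q' x
  proof -
    have "(q, q, x) \<in> ?K \<times> ?K \<times> ?K" "(q', q, x) \<in> ?K \<times> ?K \<times> ?K"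
      using that closure_subset [of D] by auto
    moreover have "dist (q', q, x) (q, q, x) < \<delta>"
      using that by (simp add: dist_Pair_Pair dist_commute)
    ultimately have "dist (h (q', q, x)) (h (q, q, x)) < \<kappa>" using \<delta>(2) by blast
    then show ?thesis by (simp add: h_def hmult_hinv dist_commute)
  qed
  then show ?thesis using \<delta>(1) by blast
qed

lemma frontier_point_near:
  fixes x :: heis
  assumes "x \<in> D" "\<not> ball x r \<subseteq> D" "0 < r"
  shows "\<exists>q\<in>frontier D. dist x q < r"
proof -
  have "ball x r \<inter> frontier D \<noteq> {}"
  proof (rule connected_Int_frontier [OF connected_ball])
    have "x \<in> ball x r" using assms(3) by simp
    then show "ball x r \<inter> D \<noteq> {}" using assms(1) by blast
    show "ball x r - D \<noteq> {}" using assms(2) by blast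
  qed
  then show ?thesis by auto
qed

text \<open>A bound \<open>\<eta>\<close> on the oscillation under a small left translation propagates from the
  boundary layer to the interior, since each application of the operator shrinks the excess over \<open>\<eta>\<close>,
  measured against the barrier, by the factor \<open>\<theta>\<close>.\<close>

lemma translated_solution_close:
  assumes p: "2 < p" and D: "bounded D" and \<epsilon>: "0 < \<epsilon>" "\<epsilon> < 1"
    and u: "bdd_cont_solution p D F \<epsilon> u"
    and layer: "\<And>x. x \<in> D \<Longrightarrow> x \<notin> S \<Longrightarrow> \<bar>u x - u (g \<star> x)\<bar> \<le> \<eta>"
    and inner: "\<And>x. x \<in> S \<Longrightarrow> hball x ((gamma_p p + 1) * \<epsilon>) \<subseteq> D"
      "\<And>x. x \<in> S \<Longrightarrow> d_cut D \<epsilon> x = 1 \<and> d_cut D \<epsilon> (g \<star> x) = 1"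
    and \<eta>: "0 \<le> \<eta>" and x: "x \<in> D"
  shows "\<bar>u x - u (g \<star> x)\<bar> \<le> \<eta>"
proof -
  obtain \<phi> \<theta> C where "is_barrier D \<epsilon> \<phi> \<theta> C"
    using ex_barrier [OF D \<epsilon>] by blast
  then have \<phi>: "\<phi> \<in> bcontfun" "0 < \<theta>" "\<theta> < 1" "\<And>q. 1 \<le> \<phi> q" "\<And>q. \<phi> q \<le> C"
    "\<And>q. q \<in> D \<Longrightarrow> 1/3 * average3 \<phi> \<epsilon> q + 2/3 * C \<le> \<theta> * \<phi> q"
    by (auto simp: is_barrier_def)
  have ub: "u \<in> bcontfun" and u_eq: "\<And>q. u q = mv_fixpoint_map p D F \<epsilon> u q"
    using u unfolding bdd_cont_solution_iff by metis+
  note vb = bcontfun_left_translate [OF ub, of g]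
  obtain K where K: "0 < K" "\<And>x. \<bar>u x\<bar> \<le> K" using bcontfun_bound [OF ub] by blast
  \<comment> \<open>Where the cutoff is 1 the term with \<open>F\<close> drops out, so
    \<open>u\<close> is reproduced by the operator alone.\<close>
  have fix1: "u y = mv_operator p \<epsilon> u y" if "d_cut D \<epsilon> y = 1" for y
  proof -
    have "mv_fixpoint_map p D F \<epsilon> u y = mv_operator p \<epsilon> u y"
      by (simp add: mv_fixpoint_map_def that)
    then show ?thesis using u_eq by (rule trans [rotated])
  qed
  \<comment> \<open>The induction starts from the trivial bound \<open>2 * K\<close>, the
    oscillation of a function bounded by \<open>K\<close>.\<close>
  have bound: "\<bar>u y - u (g \<star> y)\<bar> \<le> \<eta> + 2 * K * \<theta> ^ n * \<phi> y" if "y \<in> D" for n y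
    using that
  proof (induction n arbitrary: y)
    case 0
    have "2 * K * 1 \<le> 2 * K * \<phi> y" using \<phi>(4) K(1) by (intro mult_left_mono) auto
    then show ?case using K(2) [of y] K(2) [of "g \<star> y"] \<eta> by simp
  next
    case (Suc n)
    have m: "0 \<le> 2 * K * \<theta> ^ n" using K(1) \<phi>(2) by simp
    show ?case
    proof (cases "y \<in> S")
      case True
      have "\<bar>mv_operator p \<epsilon> u y - mv_operator p \<epsilon> (\<lambda>x. u (g \<star> x)) y\<bar>
          \<le> \<eta> + 2 * K * \<theta> ^ n * (1/3 * average3 \<phi> \<epsilon> y + 2/3 * C)"
        using Suc.IH inner(1) [OF True]
        by (intro mv_operator_abs_diff_le [OF p \<epsilon>(1) ub vb \<phi>(1,5) m]) blast
      also have "\<dots> \<le> \<eta> + 2 * K * \<theta> ^ n * (\<theta> * \<phi> y)"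
        using \<phi>(6) [OF Suc.prems] m by (intro add_left_mono mult_left_mono)
      also have "mv_operator p \<epsilon> u y = u y"
        using inner(2) [OF True] by (intro fix1 [symmetric]) blast
      also have "mv_operator p \<epsilon> (\<lambda>x. u (g \<star> x)) y = u (g \<star> y)"
        unfolding mv_operator_left_translate [OF p \<epsilon>(1) ub]
        using inner(2) [OF True] by (intro fix1 [symmetric]) blast
      finally show ?thesis by (simp add: mult_ac)
    next
      case False
      have "0 \<le> 2 * K * \<theta> ^ Suc n * \<phi> y"
        using K(1) \<phi>(2) \<phi>(4) [of y] by (intro mult_nonneg_nonneg) auto
      then show ?thesis using layer [OF Suc.prems False] by linarith
    qed
  qed
  have "(\<lambda>n. \<eta> + 2 * K * \<theta> ^ n * \<phi> x) \<longlonglongrightarrow> \<eta> + 2 * K * 0 * \<phi> x"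
    using \<phi>(2,3) by (intro tendsto_intros LIMSEQ_realpow_zero) auto
  then have "\<bar>u x - u (g \<star> x)\<bar> \<le> \<eta> + 2 * K * 0 * \<phi> x"
    by (rule LIMSEQ_le_const) (use bound [OF x] in blast)
  then show ?thesis by simp
qed

lemma hball_mono: "r \<le> s \<Longrightarrow> hball q r \<subseteq> hball q s"
  by (auto simp: hball_def)

lemma game_regular_equicontinuous:
  assumes p: "2 < p" and oD: "open D" and D: "bounded D" and reg: "game_regular p D"
    and F: "F \<in> bcontfun" and \<eta>: "0 < \<eta>"
  shows "\<exists>\<delta>>0. \<exists>\<epsilon>'\<in>{0<..<1}. \<forall>\<epsilon>\<in>{0<..<\<epsilon>'}. \<forall>q\<in>D. \<forall>q'\<in>D.
    dist q q' < \<delta> \<longrightarrow> \<bar>u_eps p D F \<epsilon> q - u_eps p D F \<epsilon> q'\<bar> \<le> \<eta>"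
proof -
  obtain e \<epsilon>1 where e: "0 < e" and \<epsilon>1: "\<epsilon>1 \<in> {0<..<1}"
    and osc: "\<And>\<epsilon> q0 x y. \<epsilon> \<in> {0<..<\<epsilon>1} \<Longrightarrow> q0 \<in> frontier D \<Longrightarrow> x \<in> ball q0 e \<Longrightarrow> y \<in> ball q0 e \<Longrightarrow>
      \<bar>u_eps p D F \<epsilon> x - u_eps p D F \<epsilon> y\<bar> \<le> \<eta>"
    using game_regular_boundary_oscillation [OF p D reg F \<eta>] by blast
  \<comment> \<open>A point of \<open>D\<close> outside \<open>S\<close> below is within
    \<open>\<kappa>\<close> of a boundary point, and its translate within
    \<open>\<kappa> + \<kappa> / 2\<close>. Both lie in the \<open>e\<close>-ball of that boundary
    point.\<close>
  define \<kappa> where "\<kappa> = e / 2"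
  have \<kappa>: "0 < \<kappa>" "0 < \<kappa> / 2" "\<kappa> + \<kappa> = e" using e by (auto simp: \<kappa>_def)
  obtain r where r: "0 < r" "\<And>q. q \<in> D \<Longrightarrow> hball q r \<subseteq> ball q (\<kappa> / 2)"
    using hball_subset_ball [OF D \<kappa>(2)] by blast
  obtain \<delta> where \<delta>: "0 < \<delta>"
    "\<And>q q' x. q \<in> D \<Longrightarrow> q' \<in> D \<Longrightarrow> x \<in> D \<Longrightarrow> dist q q' < \<delta> \<Longrightarrow> dist x (q' \<star> hinv q \<star> x) < \<kappa> / 2"
    using left_translation_uniform [OF D \<kappa>(2)] by blast
  \<comment> \<open>One round reaches at most \<open>(gamma_p p + 1) * \<epsilon>\<close>, which is
    now at most \<open>r\<close>. From a point of \<open>S\<close> it therefore stays in a Euclidean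
    ball of radius \<open>\<kappa> / 2\<close> inside \<open>D\<close>.\<close>
  define \<epsilon>' where "\<epsilon>' = min \<epsilon>1 (r / (gamma_p p + 1))"
  have \<gamma>: "0 < gamma_p p" by (rule gamma_p_pos [OF p])
  have \<epsilon>': "\<epsilon>' \<in> {0<..<1}" using \<epsilon>1 r(1) \<gamma> by (auto simp: \<epsilon>'_def)
  have "\<bar>u_eps p D F \<epsilon> q - u_eps p D F \<epsilon> q'\<bar> \<le> \<eta>"
    if \<epsilon>: "\<epsilon> \<in> {0<..<\<epsilon>'}" and q: "q \<in> D" "q' \<in> D" "dist q q' < \<delta>" for \<epsilon> q q'
  proof -
    have \<epsilon>01: "0 < \<epsilon>" "\<epsilon> < 1" "\<epsilon> \<in> {0<..<\<epsilon>1}" using \<epsilon> \<epsilon>1 by (auto simp: \<epsilon>'_def)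
    have \<epsilon>r: "(gamma_p p + 1) * \<epsilon> \<le> r"
    proof -
      have "\<epsilon> < r / (gamma_p p + 1)" using \<epsilon> by (simp add: \<epsilon>'_def)
      then show ?thesis using \<gamma> by (simp add: pos_less_divide_eq mult.commute less_imp_le)
    qed
    moreover have "0 < gamma_p p * \<epsilon>" using \<gamma> \<epsilon>01(1) by simp
    ultimately have \<epsilon>r': "\<epsilon> \<le> r" by (simp add: distrib_right)
    \<comment> \<open>Left translation by \<open>g\<close> carries \<open>q\<close> to
      \<open>q'\<close>, so the comparison at the single point \<open>q\<close> is the
      claim.\<close>
    define g where "g = q' \<star> hinv q"
    have g: "dist x (g \<star> x) < \<kappa> / 2" if "x \<in> D" for x
      using \<delta>(2) [OF q(1,2) that q(3)] by (simp add: g_def)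
    define S where "S = {x \<in> D. ball x \<kappa> \<subseteq> D}"
    let ?u = "u_eps p D F \<epsilon>"
    have "\<bar>?u q - ?u (g \<star> q)\<bar> \<le> \<eta>"
    proof (rule translated_solution_close [OF p D \<epsilon>01(1,2) u_eps_solution [OF p D F \<epsilon>01(1,2)]])
      show "\<bar>?u x - ?u (g \<star> x)\<bar> \<le> \<eta>" if x: "x \<in> D" "x \<notin> S" for x
      proof -
        obtain q0 where q0: "q0 \<in> frontier D" "dist x q0 < \<kappa>"
          using frontier_point_near [of x D \<kappa>] x \<kappa>(1) by (auto simp: S_def)
        have "dist q0 (g \<star> x) \<le> dist x q0 + dist x (g \<star> x)"
          by (metis dist_commute dist_triangle)
        then have "x \<in> ball q0 e" "g \<star> x \<in> ball q0 e"
          using q0(2) g [OF x(1)] \<kappa> by (simp_all add: dist_commute)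
        then show ?thesis using osc [OF \<epsilon>01(3) q0(1)] by blast
      qed
      show "hball x ((gamma_p p + 1) * \<epsilon>) \<subseteq> D" if "x \<in> S" for x
      proof -
        have "x \<in> D" "ball x \<kappa> \<subseteq> D" using that by (auto simp: S_def)
        moreover have "ball x (\<kappa> / 2) \<subseteq> ball x \<kappa>" using \<kappa> by (intro subset_ball) simp
        ultimately show ?thesis using hball_mono [OF \<epsilon>r] r(2) by blast
      qed
      show "d_cut D \<epsilon> x = 1 \<and> d_cut D \<epsilon> (g \<star> x) = 1" if "x \<in> S" for x
      proof -
        have x: "x \<in> D" "ball x \<kappa> \<subseteq> D" using that by (auto simp: S_def)
        have gx: "dist x (g \<star> x) < \<kappa> / 2" by (rule g [OF x(1)])
        have 1: "ball x (\<kappa> / 2) \<subseteq> D"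
          using x(2) subset_ball [of "\<kappa> / 2" \<kappa> x] \<kappa> by fastforce
        have 2: "ball (g \<star> x) (\<kappa> / 2) \<subseteq> D"
        proof
          fix y assume "y \<in> ball (g \<star> x) (\<kappa> / 2)"
          then have "dist x y < \<kappa>"
            using gx dist_triangle [of x y "g \<star> x"] by simp
          then show "y \<in> D" using x(2) by auto
        qed
        have gxD: "g \<star> x \<in> D" using 2 \<kappa>(2) by (meson centre_in_ball subsetD)
        have "hball x \<epsilon> \<subseteq> D" "hball (g \<star> x) \<epsilon> \<subseteq> D"
          using hball_mono [OF \<epsilon>r'] r(2) x(1) gxD 1 2 by blast+
        then show ?thesis using d_cut_eq_1 [OF D \<epsilon>01(1)] by blast
      qed
    qed (use \<eta> q in auto)
    then show ?thesis by (simp add: g_def hmult_assoc hmult_hinv)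
  qed
  then show ?thesis using \<delta>(1) \<epsilon>' by blast
qed

theorem theorem13p5:
  fixes p :: real and D :: "heis set" and F :: "heis \<Rightarrow> real"
  assumes "p > 2"
    and "open D" "bounded D" "connected D"
    and "game_regular p D"
    and "continuous_on UNIV F" "bounded (range F)"
  shows "(\<forall>\<epsilon>\<in>{0<..<1}. \<exists>!u. bdd_cont_solution p D F \<epsilon> u)
       \<and> equicontinuous_family (closure D) (u_eps p D F)"
proof
  have F: "F \<in> bcontfun" using assms(6,7) by (simp add: bcontfun_iff)
  show "\<forall>\<epsilon>\<in>{0<..<1}. \<exists>!u. bdd_cont_solution p D F \<epsilon> u"
    using ex1_bdd_cont_solution [OF assms(1,3) F] by simp
  show "equicontinuous_family (closure D) (u_eps p D F)"
    unfolding equicontinuous_family_def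
  proof (intro allI impI)
    fix \<eta> :: real assume \<eta>: "0 < \<eta>"
    obtain \<delta> \<epsilon>' where \<delta>: "0 < \<delta>" and \<epsilon>': "\<epsilon>' \<in> {0<..<1}"
      and close: "\<And>\<epsilon> q q'. \<epsilon> \<in> {0<..<\<epsilon>'} \<Longrightarrow> q \<in> D \<Longrightarrow> q' \<in> D \<Longrightarrow> dist q q' < \<delta> \<Longrightarrow>
        \<bar>u_eps p D F \<epsilon> q - u_eps p D F \<epsilon> q'\<bar> \<le> \<eta>"
      using game_regular_equicontinuous [OF assms(1,2,3,5) F \<eta>] by blast
    \<comment> \<open>Halving \<open>\<delta>\<close> turns the weak inequality into a strict one,
      which sequences in \<open>D\<close> approximating \<open>q\<close> and \<open>q'\<close>
      eventually satisfy.\<close>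
    have "\<bar>u_eps p D F \<epsilon> q - u_eps p D F \<epsilon> q'\<bar> \<le> \<eta>"
      if \<epsilon>: "\<epsilon> \<in> {0<..<\<epsilon>'}" and q: "q \<in> closure D" "q' \<in> closure D" "norm (q - q') \<le> \<delta> / 2"
      for \<epsilon> q q'
    proof -
      have "0 < \<epsilon>" "\<epsilon> < 1" using \<epsilon> \<epsilon>' by auto
      from u_eps_solution [OF assms(1,3) F this]
      have c: "continuous_on UNIV (u_eps p D F \<epsilon>)"
        by (simp add: bdd_cont_solution_def)
      obtain x where x: "\<And>n. x n \<in> D" "x \<longlonglongrightarrow> q"
        using q(1) unfolding closure_sequential by blast
      obtain y where y: "\<And>n. y n \<in> D" "y \<longlonglongrightarrow> q'"
        using q(2) unfolding closure_sequential by blast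
      have lim: "(\<lambda>n. \<bar>u_eps p D F \<epsilon> (x n) - u_eps p D F \<epsilon> (y n)\<bar>)
          \<longlonglongrightarrow> \<bar>u_eps p D F \<epsilon> q - u_eps p D F \<epsilon> q'\<bar>"
        using c x(2) y(2) unfolding continuous_on_sequentially comp_def
        by (intro tendsto_rabs tendsto_diff) blast+
      have "(\<lambda>n. dist (x n) (y n)) \<longlonglongrightarrow> dist q q'"
        by (rule tendsto_dist [OF x(2) y(2)])
      moreover have "dist q q' < \<delta>" using q(3) \<delta> by (simp add: dist_norm)
      ultimately have "\<forall>\<^sub>F n in sequentially. dist (x n) (y n) < \<delta>"
        by (rule order_tendstoD)
      then have "\<forall>\<^sub>F n in sequentially. \<bar>u_eps p D F \<epsilon> (x n) - u_eps p D F \<epsilon> (y n)\<bar> \<le> \<eta>"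
        by (rule eventually_mono) (rule close [OF \<epsilon> x(1) y(1)])
      then show ?thesis
        by (rule tendsto_upperbound [OF lim]) simp
    qed
    moreover have "0 < \<delta> / 2" using \<delta> by simp
    ultimately show "\<exists>\<delta>>0. \<exists>\<epsilon>'\<in>{0<..<1}. \<forall>\<epsilon>\<in>{0<..<\<epsilon>'}. \<forall>q\<in>closure D. \<forall>q'\<in>closure D.
        norm (q - q') \<le> \<delta> \<longrightarrow> \<bar>u_eps p D F \<epsilon> q - u_eps p D F \<epsilon> q'\<bar> \<le> \<eta>"
      using \<epsilon>' by blast
  qed
qed

end
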